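(* Let $\mathbb{P}$ be the pentablock, $\overline{\mathbb{P}}$ its closure, $b\overline{\mathbb{P}}$ its distinguished boundary, and $V(\mathbb{P})=\{(a,s,p)\in\overline{\mathbb{P}} : s^2=4p\}$. For $\omega\in\mathbb{T}$ and $v\in\mathrm{Aut}(\mathbb{D})$ let $f_{\omega v}$ be the automorphism of $\mathbb{P}$ (extended to $\overline{\mathbb{P}}$) whose explicit formula is given in the context. Then \[ b\overline{\mathbb{P}}=\{f_{\omega v}(1,0,1),\ f_{\omega v}(0,2,1) : \omega\in\mathbb{T},\ v\in\mathrm{Aut}(\mathbb{D})\}. \] Moreover, \[ b\overline{\mathbb{P}}\cap V(\mathbb{P})=\{f_{\omega v}(0,2,1) : \omega\in\mathbb{T},\ v\in\mathrm{Aut}(\mathbb{D})\}\quad\text{and}\quad b\overline{\mathbb{P}}\setminus V(\mathbb{P})=\{f_{\omega v}(1,0,1) : \omega\in\mathbb{T},\ v\in\mathrm{Aut}(\mathbb{D})\}. \]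
   Context: $\mathbb{D}$ is the open unit disc in $\mathbb{C}$ and $\mathbb{T}$ is the unit circle. $\mathrm{Aut}(\mathbb{D})$ is the group of biholomorphic self-maps of $\mathbb{D}$; its elements are exactly the maps $v=\eta B_\alpha$ with $\eta\in\mathbb{T}$, $\alpha\in\mathbb{D}$, where $B_\alpha(z)=\frac{z-\alpha}{\overline{\alpha}z-1}$, and each is regarded as extended by the same formula to $\overline{\mathbb{D}}$. The pentablock is $\mathbb{P}=\{(a_{21},\operatorname{tr}A,\det A)\in\mathbb{C}^3 : A=[a_{ij}]\in M_2(\mathbb{C}),\ \|A\|<1\}$ (operator norm). Let $\Gamma_2=\{(z_1+z_2,z_1z_2) : z_1,z_2\in\overline{\mathbb{D}}\}$ be the closed symmetrized bidisc; if $(a,s,p)\in\overline{\mathbb{P}}$ then $(s,p)\in\Gamma_2$. For $v\in\mathrm{Aut}(\mathbb{D})$ define $\tau_v:\Gamma_2\to\Gamma_2$ by $\tau_v(z_1+z_2,z_1z_2)=(v(z_1)+v(z_2),v(z_1)v(z_2))$ for $z_1,z_2\in\overline{\mathbb{D}}$. For $\omega\in\mathbb{T}$ and $v=\eta B_\alpha\in\mathrm{Aut}(\mathbb{D})$, define \[ f_{\omega v}(a,s,p)=\left(\frac{\omega\eta(1-|\alpha|^2)a}{1-\overline{\alpha}s+\overline{\alpha}^2p},\ \tau_v(s,p)\right)\qquad((a,s,p)\in\overline{\mathbb{P}}), \] where the pair $\tau_v(s,p)$ gives the second and third coordinates. For a bounded domain $\Omega\subset\mathbb{C}^n$, $A(\Omega)$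 is the algebra of continuous functions on $\overline{\Omega}$ that are holomorphic in $\Omega$. A boundary for $\Omega$ is a subset of $\overline{\Omega}$ on which every function in $A(\Omega)$ attains its maximum modulus; the distinguished boundary $b\overline{\Omega}$ is the smallest closed boundary. It is known (Agler, Lykova and Young) that \[ b\overline{\mathbb{P}}=\{(a,s,p)\in\mathbb{C}^3 : |a|^2+|s|^2/4=1,\ (s,p)\in b\Gamma_2\}, \] where $b\Gamma_2=\{(s,p)\in\mathbb{C}^2 : |s|\le2,\ s=\overline{s}p,\ |p|=1\}=\{(z_1+z_2,z_1z_2) : |z_1|=|z_2|=1\}$. *)

theory Defs
  imports "HOL-Complex_Analysis.Complex_Analysis"
begin

type_synonym complex3 = "complex \<times> complex \<times> complex"

text \<open>Holomorphy in several variables: the Frechet derivative at each point exists and is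
  complex-linear, i.e. of the form \<open>(x, y, z) \<mapsto> c\<^sub>1 x + c\<^sub>2 y + c\<^sub>3 z\<close>.\<close>

definition holomorphic3_on :: "(complex3 \<Rightarrow> complex) \<Rightarrow> complex3 set \<Rightarrow> bool" where
  "holomorphic3_on f \<Omega> \<longleftrightarrow>
     (\<forall>w\<in>\<Omega>. \<exists>c1 c2 c3.
        (f has_derivative (\<lambda>(x, y, z). c1 * x + c2 * y + c3 * z)) (at w within \<Omega>))"

definition boundary_algebra :: "complex3 set \<Rightarrow> (complex3 \<Rightarrow> complex) set" where
  "boundary_algebra \<Omega> = {f. continuous_on (closure \<Omega>) f \<and> holomorphic3_on f \<Omega>}"

definition is_boundary :: "complex3 set \<Rightarrow> complex3 set \<Rightarrow> bool" where
  "is_boundary \<Omega> B \<longleftrightarrow>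
     B \<subseteq> closure \<Omega> \<and>
     (\<forall>f\<in>boundary_algebra \<Omega>. \<exists>w\<in>B. \<forall>w'\<in>closure \<Omega>. norm (f w') \<le> norm (f w))"

text \<open>\<open>LEAST\<close> is with respect to inclusion.\<close>

definition distinguished_boundary :: "complex3 set \<Rightarrow> complex3 set" where
  "distinguished_boundary \<Omega> = (LEAST B. closed B \<and> is_boundary \<Omega> B)"

definition pentablock :: "complex3 set" where
  "pentablock = {(A $ 2 $ 1, trace A, det A) | A :: complex ^ 2 ^ 2. onorm (\<lambda>x. A *v x) < 1}"

definition pentablock_variety :: "complex3 set" where
  "pentablock_variety = {(a, s, p). (a, s, p) \<in> closure pentablock \<and> s\<^sup>2 = 4 * p}"

abbreviation unit_disc :: "complex set" where
  "unit_disc \<equiv> ball 0 1"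

abbreviation unit_circle :: "complex set" where
  "unit_circle \<equiv> sphere 0 1"

definition aut_disc :: "(complex \<Rightarrow> complex) set" where
  "aut_disc = {v. bij_betw v unit_disc unit_disc \<and> v holomorphic_on unit_disc \<and>
                  inv_into unit_disc v holomorphic_on unit_disc}"

definition blaschke :: "complex \<Rightarrow> complex \<Rightarrow> complex" where
  "blaschke \<alpha> z = (z - \<alpha>) / (cnj \<alpha> * z - 1)"

text \<open>The unique \<open>(\<eta>, \<alpha>)\<close> such that \<open>v = \<eta> B\<^sub>\<alpha>\<close> on the open disc; it exists for every disc
  automorphism. Values of \<open>v\<close> outside the open disc are irrelevant: \<open>aut_ext\<close> is the extension of
  \<open>v\<close> to the closed disc by the same formula.\<close>

definition aut_params :: "(complex \<Rightarrow> complex) \<Rightarrow> complex \<times> complex" where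
  "aut_params v = (THE (\<eta>, \<alpha>). \<eta> \<in> unit_circle \<and> \<alpha> \<in> unit_disc \<and>
                                (\<forall>z\<in>unit_disc. v z = \<eta> * blaschke \<alpha> z))"

definition aut_ext :: "(complex \<Rightarrow> complex) \<Rightarrow> complex \<Rightarrow> complex" where
  "aut_ext v z = (case aut_params v of (\<eta>, \<alpha>) \<Rightarrow> \<eta> * blaschke \<alpha> z)"

text \<open>On the closed symmetrized bidisc; the value does not depend on the choice of \<open>z1\<close>, \<open>z2\<close>,
  which are determined by \<open>(s, p)\<close> up to order.\<close>

definition tau :: "(complex \<Rightarrow> complex) \<Rightarrow> complex \<times> complex \<Rightarrow> complex \<times> complex" where
  "tau v sp = (THE w. \<exists>z1\<in>cball 0 1. \<exists>z2\<in>cball 0 1.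
                 sp = (z1 + z2, z1 * z2) \<and>
                 w = (aut_ext v z1 + aut_ext v z2, aut_ext v z1 * aut_ext v z2))"

definition penta_aut :: "complex \<Rightarrow> (complex \<Rightarrow> complex) \<Rightarrow> complex3 \<Rightarrow> complex3" where
  "penta_aut \<omega> v = (\<lambda>(a, s, p). case aut_params v of (\<eta>, \<alpha>) \<Rightarrow>
     (\<omega> * \<eta> * (1 - (norm \<alpha>)\<^sup>2) * a / (1 - cnj \<alpha> * s + (cnj \<alpha>)\<^sup>2 * p), tau v (s, p)))"

end

theory Submission
  imports Defs
begin

text \<open>Every contractive \<open>2 \<times> 2\<close> matrix has a singular value decomposition \<open>U diag(x, y) V\<close>. Replacing
  \<open>x, y\<close> by the values of Moebius maps of the disc gives an analytic disc in the pentablock through a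
  given point whose boundary consists of images of unitary matrices. The unitary points over a fixed
  \<open>(s, p)\<close> in turn fill the disc \<open>\<bar>a\<bar>\<^sup>2 \<le> 1 - \<bar>s\<bar>\<^sup>2 / 4\<close>, so two applications of the maximum principle
  push the maximum modulus to \<open>\<bar>a\<bar>\<^sup>2 + \<bar>s\<bar>\<^sup>2 / 4 = 1\<close>. Conversely each such point \<open>(a\<^sub>0, s\<^sub>0, p\<^sub>0)\<close> is the
  only peak of the polynomial \<open>(1 + cnj a\<^sub>0 a + cnj s\<^sub>0 s / 4) (1 + cnj p\<^sub>0 p)\<close> on the closure.
  Finally \<open>(1, 0, 1)\<close> and \<open>(0, 2, 1)\<close> reach all these points already through the parameters
  \<open>\<alpha>\<close> real, respectively \<open>\<alpha> = 0\<close>.\<close>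

unbundle no fps_syntax

section \<open>Unit vectors in the plane and the singular value decomposition\<close>

lemma cmod2_eq: "complex_of_real ((cmod z)\<^sup>2) = z * cnj z"
  by (rule complex_norm_square)

lemma cmod2_sum_eq_1_iff: "(cmod p)\<^sup>2 + (cmod q)\<^sup>2 = 1 \<longleftrightarrow> p * cnj p + q * cnj q = 1"
  by (metis cmod2_eq of_real_1 of_real_add of_real_eq_iff)

text \<open>\<open>(p, q)\<close> and \<open>(- cnj q, cnj p)\<close> are the columns of a matrix in
  \<open>SU(2)\<close>; applied to \<open>(X, Y)\<close> it preserves the norm because the cross
  terms cancel.\<close>

lemma unitary_norm:
  assumes "(cmod p)\<^sup>2 + (cmod q)\<^sup>2 = 1"
  shows "(cmod (X * p - Y * cnj q))\<^sup>2 + (cmod (X * q + Y * cnj p))\<^sup>2 = (cmod X)\<^sup>2 + (cmod Y)\<^sup>2"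
proof -
  have "complex_of_real ((cmod (X * p - Y * cnj q))\<^sup>2 + (cmod (X * q + Y * cnj p))\<^sup>2)
    = (X * cnj X + Y * cnj Y) * (p * cnj p + q * cnj q)"
    unfolding of_real_add cmod2_eq by (simp add: algebra_simps)
  also have "\<dots> = complex_of_real ((cmod X)\<^sup>2 + (cmod Y)\<^sup>2)"
    using assms unfolding of_real_add cmod2_eq cmod2_sum_eq_1_iff by simp
  finally show ?thesis
    using of_real_eq_iff by blast
qed

text \<open>Normalisation that also covers the zero vector, with \<open>\<sigma> = 0\<close>, so
  that degenerate matrices pass through the decomposition.\<close>

lemma obtain_unit_multiple:
  fixes x y :: complex
  obtains p q \<sigma> where "(cmod p)\<^sup>2 + (cmod q)\<^sup>2 = 1" "x = \<sigma> * p" "y = \<sigma> * q"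
    "x \<noteq> 0 \<or> y \<noteq> 0 \<Longrightarrow> \<sigma> \<noteq> 0"
proof (cases "x = 0 \<and> y = 0")
  case True
  then show ?thesis by (intro that[of 1 0 0]) auto
next
  case False
  define n where "n = sqrt ((cmod x)\<^sup>2 + (cmod y)\<^sup>2)"
  have n: "n > 0" "n\<^sup>2 = (cmod x)\<^sup>2 + (cmod y)\<^sup>2"
    using False by (auto simp: n_def add_pos_nonneg add_nonneg_pos)
  have "(cmod (x / n))\<^sup>2 + (cmod (y / n))\<^sup>2 = ((cmod x)\<^sup>2 + (cmod y)\<^sup>2) / n\<^sup>2"
    by (simp add: norm_divide power_divide add_divide_distrib)
  also have "\<dots> = 1" unfolding n(2)[symmetric] using n(1) by simp
  finally have "(cmod (x / n))\<^sup>2 + (cmod (y / n))\<^sup>2 = 1" .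
  moreover have "complex_of_real n \<noteq> 0" using n by simp
  moreover from this have "x = n * (x / n)" "y = n * (y / n)" by simp_all
  ultimately show ?thesis using that by blast
qed

text \<open>The orthogonal complement of a unit vector \<open>(p, q)\<close> is the line through
  \<open>(- cnj q, cnj p)\<close>, so two orthogonal vectors are multiples of the columns of one
  matrix in \<open>SU(2)\<close>. If the first vanishes, the second fixes the frame.\<close>

lemma orthogonal_pair:
  fixes x1 x2 y1 y2 :: complex
  assumes "y1 * cnj x1 + y2 * cnj x2 = 0"
  obtains p q \<sigma> \<sigma>' where "(cmod p)\<^sup>2 + (cmod q)\<^sup>2 = 1" "x1 = \<sigma> * p" "x2 = \<sigma> * q"
    "y1 = - \<sigma>' * cnj q" "y2 = \<sigma>' * cnj p"
proof (cases "x1 = 0 \<and> x2 = 0")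
  case True
  obtain p q \<sigma> where *: "(cmod p)\<^sup>2 + (cmod q)\<^sup>2 = 1" "y1 = \<sigma> * p" "y2 = \<sigma> * q"
    using obtain_unit_multiple by metis
  \<comment> \<open>Swapping and conjugating makes \<open>(p, q)\<close>, the direction of
    \<open>(y1, y2)\<close>, the second column.\<close>
  show ?thesis
    using * True by (intro that[of "cnj q" "- cnj p" 0 \<sigma>]) auto
next
  case False
  obtain p q \<sigma> where *: "(cmod p)\<^sup>2 + (cmod q)\<^sup>2 = 1" "x1 = \<sigma> * p" "x2 = \<sigma> * q" "\<sigma> \<noteq> 0"
    using obtain_unit_multiple[of x1 x2] False by metis
  have "cnj \<sigma> * (y1 * cnj p + y2 * cnj q) = 0"
    using assms unfolding * by (simp add: algebra_simps)
  then have o: "y1 * cnj p + y2 * cnj q = 0" using * by simp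
  have u: "p * cnj p + q * cnj q = 1" using * cmod2_sum_eq_1_iff by simp
  \<comment> \<open>The inner product of \<open>(y1, y2)\<close> with the unit vector
    \<open>(- cnj q, cnj p)\<close>.\<close>
  define \<sigma>' where "\<sigma>' = y2 * p - y1 * q"
  have "y1 = - \<sigma>' * cnj q" "y2 = \<sigma>' * cnj p"
    unfolding \<sigma>'_def using o u by algebra+
  then show ?thesis
    using * that by metis
qed

text \<open>The columns \<open>(e, f)\<close> and \<open>(- cnj f, cnj e)\<close> of
  \<open>V\<close> are eigenvectors of \<open>A\<^sup>* A\<close>, hence have orthogonal images,
  which \<open>orthogonal_pair\<close> writes through the columns of \<open>U\<close>. Both
  unitaries have determinant one; the phases go into the complex numbers \<open>\<sigma>\<close> and
  \<open>\<sigma>'\<close>.\<close>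

lemma svd2:
  fixes a b c d :: complex
  obtains p q e f \<sigma> \<sigma>' where
    "(cmod p)\<^sup>2 + (cmod q)\<^sup>2 = 1" "(cmod e)\<^sup>2 + (cmod f)\<^sup>2 = 1"
    "a * e + b * f = \<sigma> * p" "c * e + d * f = \<sigma> * q"
    "b * cnj e - a * cnj f = - \<sigma>' * cnj q" "d * cnj e - c * cnj f = \<sigma>' * cnj p"
proof -
  define h k l where "h = a * cnj a + c * cnj c" and "k = b * cnj a + d * cnj c"
    and "l = b * cnj b + d * cnj d"
  \<comment> \<open>\<open>(1, z)\<close> will be an eigenvector of \<open>A\<^sup>* A\<close>, whose entries are \<open>h, k, cnj k, l\<close>.\<close>
  obtain z where z: "- k * z\<^sup>2 + (l - h) * z + cnj k = 0"
  proof (cases "k = 0")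
    case True
    then show ?thesis by (intro that[of 0]) auto
  next
    case False
    define D where "D = csqrt ((l - h)\<^sup>2 + 4 * k * cnj k)"
    have D: "D\<^sup>2 = (l - h)\<^sup>2 + 4 * k * cnj k" by (simp add: D_def)
    have "4 * k * (- k * z\<^sup>2 + (l - h) * z + cnj k) = 0" if "z = (l - h + D) / (2 * k)" for z
    proof -
      have "2 * k * z = l - h + D" using that False by simp
      then show ?thesis using D by algebra
    qed
    then show ?thesis using that False by (metis mult_eq_0_iff zero_neq_numeral)
  qed
  obtain e f \<sigma> where ef: "(cmod e)\<^sup>2 + (cmod f)\<^sup>2 = 1" "1 = \<sigma> * e" "z = \<sigma> * f" "\<sigma> \<noteq> 0"
    using obtain_unit_multiple[of 1 z] by (metis zero_neq_one)
  \<comment> \<open>Homogeneous form of the eigenvector equation; this \<open>\<sigma>\<close> is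
    only the normalising factor of \<open>(1, z)\<close>.\<close>
  have "\<sigma>\<^sup>2 * (- k * f\<^sup>2 + (l - h) * (e * f) + cnj k * e\<^sup>2) = 0"
  proof -
    have "\<sigma>\<^sup>2 * (- k * f\<^sup>2 + (l - h) * (e * f) + cnj k * e\<^sup>2)
      = - k * (\<sigma> * f)\<^sup>2 + (l - h) * ((\<sigma> * e) * (\<sigma> * f)) + cnj k * (\<sigma> * e)\<^sup>2"
      by (simp add: algebra_simps power2_eq_square)
    then show ?thesis using z unfolding ef(2,3)[symmetric] by simp
  qed
  then have "- k * f\<^sup>2 + (l - h) * (e * f) + cnj k * e\<^sup>2 = 0" using ef by simp
  \<comment> \<open>Since \<open>h\<close> and \<open>l\<close> are real, the conjugated equation is
    the orthogonality of the images of \<open>(e, f)\<close> and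
    \<open>(- cnj f, cnj e)\<close>.\<close>
  then have "cnj (- k * f\<^sup>2 + (l - h) * (e * f) + cnj k * e\<^sup>2) = 0" by simp
  then have "(b * cnj e - a * cnj f) * cnj (a * e + b * f)
      + (d * cnj e - c * cnj f) * cnj (c * e + d * f) = 0"
    unfolding h_def k_def l_def by (simp add: algebra_simps power2_eq_square)
  from orthogonal_pair[OF this] show ?thesis
    using ef that by metis
qed

section \<open>Points of the pentablock in terms of singular values\<close>

text \<open>The image \<open>(A\<^sub>2\<^sub>1, tr A, det A)\<close> of \<open>A = U diag(x, y) V\<^sup>*\<close>, where \<open>U\<close> and \<open>V\<close> in \<open>SU(2)\<close> have
  first columns \<open>(p, q)\<close> and \<open>(e, f)\<close>; \<open>x\<close> and \<open>y\<close> are complex.\<close>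

definition svd_point :: "complex \<Rightarrow> complex \<Rightarrow> complex \<Rightarrow> complex \<Rightarrow> complex \<Rightarrow> complex \<Rightarrow> complex3" where
  "svd_point p q e f x y =
     (x * (q * cnj e) - y * (cnj p * f),
      x * (p * cnj e + q * cnj f) + y * (cnj p * e + cnj q * f),
      x * y)"

lemma norm_vec2: "(norm (v :: complex ^ 2))\<^sup>2 = (cmod (v $ 1))\<^sup>2 + (cmod (v $ 2))\<^sup>2"
  by (simp add: norm_vec_def L2_set_def sum_2)

text \<open>Unitary factors preserve the norm, so the operator norm of
  \<open>U diag(x, y) V\<^sup>*\<close> is at most the larger of \<open>cmod x\<close> and
  \<open>cmod y\<close>.\<close>

lemma svd_point_in_pentablock:
  assumes pq: "(cmod p)\<^sup>2 + (cmod q)\<^sup>2 = 1" and ef: "(cmod e)\<^sup>2 + (cmod f)\<^sup>2 = 1"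
    and xy: "cmod x < 1" "cmod y < 1"
  shows "svd_point p q e f x y \<in> pentablock"
proof -
  define A :: "complex ^ 2 ^ 2" where "A = vector [
     vector [x * p * cnj e + y * cnj q * f, x * p * cnj f - y * cnj q * e],
     vector [x * q * cnj e - y * cnj p * f, x * q * cnj f + y * cnj p * e]]"
  define \<rho> where "\<rho> = max (cmod x) (cmod y)"
  have \<rho>: "0 \<le> \<rho>" "\<rho> < 1" "cmod x \<le> \<rho>" "cmod y \<le> \<rho>" using xy by (auto simp: \<rho>_def max_def)
  have "norm (A *v v) \<le> \<rho> * norm v" for v
  proof (rule power2_le_imp_le)
    \<comment> \<open>Coordinates of \<open>V\<^sup>* v\<close>; the double minus fits the shape of
      \<open>unitary_norm\<close>.\<close>
    define X Y where "X = v $ 1 * cnj e - v $ 2 * - cnj f" and "Y = v $ 2 * e - v $ 1 * f"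
    have "(A *v v) $ 1 = (x * X) * p - (y * Y) * cnj q" "(A *v v) $ 2 = (x * X) * q + (y * Y) * cnj p"
      by (simp_all add: A_def X_def Y_def matrix_vector_mult_def sum_2 algebra_simps)
    then have "(norm (A *v v))\<^sup>2 = (cmod x)\<^sup>2 * (cmod X)\<^sup>2 + (cmod y)\<^sup>2 * (cmod Y)\<^sup>2"
      using unitary_norm[OF pq] by (simp add: norm_vec2 norm_mult power_mult_distrib)
    also have "\<dots> \<le> \<rho>\<^sup>2 * (cmod X)\<^sup>2 + \<rho>\<^sup>2 * (cmod Y)\<^sup>2"
      using \<rho> by (intro add_mono mult_right_mono power_mono) auto
    also have "(cmod X)\<^sup>2 + (cmod Y)\<^sup>2 = (norm v)\<^sup>2"
      using unitary_norm[of "cnj e" "- f" "v $ 1" "v $ 2"] ef by (simp add: X_def Y_def norm_vec2 algebra_simps)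
    then have "\<rho>\<^sup>2 * (cmod X)\<^sup>2 + \<rho>\<^sup>2 * (cmod Y)\<^sup>2 = (\<rho> * norm v)\<^sup>2"
      by (metis distrib_left power_mult_distrib)
    finally show "(norm (A *v v))\<^sup>2 \<le> (\<rho> * norm v)\<^sup>2" .
  qed (use \<rho> in auto)
  then have "onorm (\<lambda>v. A *v v) \<le> \<rho>" by (rule onorm_le)
  then have "onorm (\<lambda>v. A *v v) < 1" using \<rho> by simp
  moreover have "det A = x * y"
  proof -
    have "det A = x * y * ((p * cnj p + q * cnj q) * (e * cnj e + f * cnj f))"
      by (simp add: A_def det_2 algebra_simps)
    then show ?thesis using pq ef cmod2_sum_eq_1_iff by simp
  qed
  moreover have "A $ 2 $ 1 = x * (q * cnj e) - y * (cnj p * f)" by (simp add: A_def)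
  moreover have "trace A = x * (p * cnj e + q * cnj f) + y * (cnj p * e + cnj q * f)"
    by (simp add: A_def trace_def sum_2 algebra_simps)
  ultimately show ?thesis
    unfolding pentablock_def svd_point_def by force
qed

text \<open>Applied to the two columns of \<open>V\<close>, which are unit vectors, \<open>A\<close>
  gives vectors of length \<open>cmod \<sigma>\<close> and \<open>cmod \<sigma>'\<close>, so a norm
  below one bounds both.\<close>

lemma pentablock_svd_point:
  assumes "w \<in> pentablock"
  obtains p q e f x y where
    "(cmod p)\<^sup>2 + (cmod q)\<^sup>2 = 1" "(cmod e)\<^sup>2 + (cmod f)\<^sup>2 = 1" "cmod x < 1" "cmod y < 1"
    "w = svd_point p q e f x y"
proof -
  obtain A :: "complex ^ 2 ^ 2" where A: "w = (A $ 2 $ 1, trace A, det A)" "onorm (\<lambda>x. A *v x) < 1"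
    using assms by (auto simp: pentablock_def)
  obtain p q e f \<sigma> \<sigma>' where
    pq: "(cmod p)\<^sup>2 + (cmod q)\<^sup>2 = 1" and ef: "(cmod e)\<^sup>2 + (cmod f)\<^sup>2 = 1" and
    x: "A$1$1 * e + A$1$2 * f = \<sigma> * p" "A$2$1 * e + A$2$2 * f = \<sigma> * q" and
    y: "A$1$2 * cnj e - A$1$1 * cnj f = - \<sigma>' * cnj q" "A$2$2 * cnj e - A$2$1 * cnj f = \<sigma>' * cnj p"
    using svd2 by metis
  have unit: "norm (A *v v) < 1" if "(norm v)\<^sup>2 = 1" for v
  proof -
    have "norm v = 1" using that by (simp add: power2_eq_1_iff) (smt (verit) norm_ge_zero)
    then show ?thesis
      using onorm[OF matrix_vector_mul_bounded_linear, of A v] A(2) by simp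
  qed
  have "(norm (A *v vector [e, f]))\<^sup>2 = (cmod \<sigma>)\<^sup>2 * ((cmod p)\<^sup>2 + (cmod q)\<^sup>2)"
    by (simp add: norm_vec2 matrix_vector_mult_def sum_2 x norm_mult power_mult_distrib distrib_left)
  then have 1: "cmod \<sigma> < 1"
    using unit[of "vector [e, f]"] pq ef
    by (simp add: norm_vec2[of "vector _"])
  have "(A *v vector [- cnj f, cnj e]) $ 1 = - \<sigma>' * cnj q" 
    "(A *v vector [- cnj f, cnj e]) $ 2 = \<sigma>' * cnj p"
    using y by (simp_all add: matrix_vector_mult_def sum_2)
  then have "(norm (A *v vector [- cnj f, cnj e]))\<^sup>2 = (cmod \<sigma>')\<^sup>2 * ((cmod p)\<^sup>2 + (cmod q)\<^sup>2)"
    by (simp add: norm_vec2 norm_mult power_mult_distrib algebra_simps)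
  then have 2: "cmod \<sigma>' < 1"
    using unit[of "vector [- cnj f, cnj e]"] pq ef
    by (simp add: norm_vec2[of "vector _"])
  have u: "e * cnj e + f * cnj f = 1" "p * cnj p + q * cnj q = 1"
    using ef pq cmod2_sum_eq_1_iff by auto
  \<comment> \<open>Solving for the entries amounts to
    \<open>A = U diag(\<sigma>, \<sigma>') V\<^sup>*\<close>.\<close>
  have a: "A$1$1 = \<sigma> * p * cnj e + \<sigma>' * cnj q * f" "A$1$2 = \<sigma> * p * cnj f - \<sigma>' * cnj q * e"
       "A$2$1 = \<sigma> * q * cnj e - \<sigma>' * cnj p * f" "A$2$2 = \<sigma> * q * cnj f + \<sigma>' * cnj p * e"
    using u x y by algebra+
  have "det A = \<sigma> * \<sigma>' * ((p * cnj p + q * cnj q) * (e * cnj e + f * cnj f))"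
    unfolding det_2 a by (simp add: algebra_simps)
  then have "det A = \<sigma> * \<sigma>'" using u by simp
  moreover have "trace A = \<sigma> * (p * cnj e + q * cnj f) + \<sigma>' * (cnj p * e + cnj q * f)"
    unfolding trace_def sum_2 a by (simp add: algebra_simps)
  moreover have "A$2$1 = \<sigma> * (q * cnj e) - \<sigma>' * (cnj p * f)" by (simp add: a)
  ultimately have "w = svd_point p q e f \<sigma> \<sigma>'"
    by (simp add: A svd_point_def)
  then show ?thesis using that pq ef 1 2 by blast
qed

text \<open>Here \<open>m\<close> and \<open>n\<close> are the diagonal entries of the matrix;
  \<open>a\<close> shares the first column with \<open>m\<close> and the second row with
  \<open>n\<close>. Both have norm at most one, and averaging the two bounds controls \<open>(cmod
  s)\<^sup>2 \<le> 2 * (cmod m)\<^sup>2 + 2 * (cmod n)\<^sup>2\<close>.\<close>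

lemma svd_point_bounds:
  assumes pq: "(cmod p)\<^sup>2 + (cmod q)\<^sup>2 = 1" and ef: "(cmod e)\<^sup>2 + (cmod f)\<^sup>2 = 1"
    and xy: "cmod x \<le> 1" "cmod y \<le> 1"
    and w: "svd_point p q e f x y = (a, s, t)"
  shows "(cmod a)\<^sup>2 + (cmod s)\<^sup>2 / 4 \<le> 1" "cmod t \<le> 1"
proof -
  have xy2: "(cmod x)\<^sup>2 \<le> 1" "(cmod y)\<^sup>2 \<le> 1" using xy by (auto simp: power_le_one)
  show "cmod t \<le> 1"
    using w xy by (auto simp: svd_point_def norm_mult mult_le_one)
  define m n where "m = x * p * cnj e + y * cnj q * f" and "n = x * q * cnj f + y * cnj p * e"
  have a: "a = x * q * cnj e - y * cnj p * f" and s: "s = m + n"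
    using w by (auto simp: svd_point_def m_def n_def algebra_simps)
  have le: "(cmod x)\<^sup>2 * X + (cmod y)\<^sup>2 * Y \<le> 1" if "X + Y = 1" "X \<ge> 0" "Y \<ge> 0" for X Y
    using mult_left_le_one_le[of X "(cmod x)\<^sup>2"] mult_left_le_one_le[of Y "(cmod y)\<^sup>2"] xy2 that by simp
  have "(cmod m)\<^sup>2 + (cmod a)\<^sup>2 = (cmod x)\<^sup>2 * (cmod e)\<^sup>2 + (cmod y)\<^sup>2 * (cmod f)\<^sup>2"
    using unitary_norm[OF pq, of "x * cnj e" "- y * f"]
    by (simp add: a m_def norm_mult power_mult_distrib mult_ac)
  then have 1: "(cmod m)\<^sup>2 + (cmod a)\<^sup>2 \<le> 1" using le[OF ef] by simp
  have "(cmod a)\<^sup>2 + (cmod n)\<^sup>2 = (cmod x)\<^sup>2 * (cmod q)\<^sup>2 + (cmod y)\<^sup>2 * (cmod p)\<^sup>2"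
    using unitary_norm[of "cnj e" "cnj f" "x * q" "y * cnj p"] ef
    by (simp add: a n_def norm_mult power_mult_distrib mult_ac)
  then have 2: "(cmod a)\<^sup>2 + (cmod n)\<^sup>2 \<le> 1" using le[of "(cmod q)\<^sup>2" "(cmod p)\<^sup>2"] pq by simp
  have "(cmod s)\<^sup>2 \<le> (cmod m + cmod n)\<^sup>2" unfolding s by (simp add: norm_triangle_ineq power_mono)
  also have "\<dots> \<le> 2 * (cmod m)\<^sup>2 + 2 * (cmod n)\<^sup>2"
    using sum_squares_bound[of "cmod m" "cmod n"] by (simp add: power2_sum)
  finally show "(cmod a)\<^sup>2 + (cmod s)\<^sup>2 / 4 \<le> 1" using 1 2 by simp
qed

text \<open>In \<open>s\<close> the coefficients of \<open>x\<close> and \<open>y\<close> are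
  conjugate to each other. Conjugation also inverts \<open>x\<close> and \<open>y\<close>, and
  multiplication by \<open>x * y\<close> then restores \<open>s\<close>.\<close>

lemma svd_point_unitary:
  assumes "cmod x = 1" "cmod y = 1" and w: "svd_point p q e f x y = (a, s, t)"
  shows "s = cnj s * t" "cmod t = 1"
proof -
  have "x * cnj x = 1" "y * cnj y = 1" using assms cmod2_eq[of x] cmod2_eq[of y] by auto
  moreover have "s = x * (p * cnj e + q * cnj f) + y * (cnj p * e + cnj q * f)" "t = x * y"
    using w by (auto simp: svd_point_def)
  moreover from this have "cnj s = cnj x * (cnj p * e + cnj q * f) + cnj y * (p * cnj e + q * cnj f)"
    by simp
  ultimately show "s = cnj s * t" by algebra
  show "cmod t = 1" using w assms by (auto simp: svd_point_def norm_mult)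
qed

section \<open>The candidate boundary, its slices and dilations\<close>

text \<open>The known formula for the distinguished boundary; its first equation entails
  \<open>cmod s \<le> 2\<close>. The identity is established in
  \<open>distinguished_boundary_pentablock\<close>.\<close>

definition penta_torus :: "complex3 set" where
  "penta_torus = {(a, s, p). (cmod a)\<^sup>2 + (cmod s)\<^sup>2 / 4 = 1 \<and> s = cnj s * p \<and> cmod p = 1}"

text \<open>Effect of replacing the matrix \<open>A\<close> by \<open>r A\<close>: the determinant
  has weight two.\<close>

definition dilate :: "real \<Rightarrow> complex3 \<Rightarrow> complex3" where
  "dilate r = (\<lambda>(a, s, p). (of_real r * a, of_real r * s, (of_real r)\<^sup>2 * p))"

lemma dilate_svd_point: "dilate r (svd_point p q e f x y) = svd_point p q e f (of_real r * x) (of_real r * y)"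
  by (simp add: dilate_def svd_point_def algebra_simps power2_eq_square)

text \<open>Dividing \<open>s\<close> by a square root of \<open>p\<close> gives a number equal to
  its own conjugate.\<close>

lemma symmetrized_torus:
  assumes "cmod p = 1" "s = cnj s * p" "cmod s \<le> 2"
  obtains \<eta> t where "cmod \<eta> = 1" "\<eta>\<^sup>2 = p" "s = \<eta> * of_real t" "\<bar>t\<bar> \<le> 2"
proof -
  define \<eta> where "\<eta> = csqrt p"
  have \<eta>: "\<eta>\<^sup>2 = p" by (simp add: \<eta>_def)
  then have n: "cmod \<eta> = 1" using assms(1) by (metis norm_power norm_ge_zero power2_eq_iff_nonneg one_power2 zero_le_one)
  then have u: "\<eta> * cnj \<eta> = 1" using cmod2_eq[of \<eta>] by simp
  have "s * cnj \<eta> = (cnj s * \<eta>\<^sup>2) * cnj \<eta>" using assms(2) \<eta> by simp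
  also have "\<dots> = cnj s * \<eta> * (\<eta> * cnj \<eta>)" by (simp add: power2_eq_square mult_ac)
  finally have "cnj (s * cnj \<eta>) = s * cnj \<eta>" using u by simp
  then obtain t where t: "s * cnj \<eta> = of_real t" by (metis Reals_cases Reals_cnj_iff)
  have "s = s * cnj \<eta> * \<eta>" using u by (simp add: mult_ac)
  then have "s = \<eta> * of_real t" using t by (simp add: mult.commute)
  moreover from this have "\<bar>t\<bar> \<le> 2" using assms(3) n by (simp add: norm_mult)
  ultimately show ?thesis using that \<eta> n by blast
qed

text \<open>Choose \<open>\<theta>\<close> with \<open>sin (2 * \<theta>) = cmod b\<close> and put
  the phase of \<open>b\<close> on \<open>d\<close>.\<close>

lemma obtain_double_angle:
  assumes "cmod b \<le> 1"
  obtains c d where "(cmod c)\<^sup>2 + (cmod d)\<^sup>2 = 1" "2 * (d * cnj c) = b"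
proof -
  define \<theta> where "\<theta> = arcsin (cmod b) / 2"
  have "2 * (sin \<theta> * cos \<theta>) = cmod b"
    using sin_double[of \<theta>] sin_arcsin[of "cmod b"] assms order_trans[of "-1" 0 "cmod b"]
    by (simp add: \<theta>_def mult.assoc)
  moreover have "2 * (rcis (sin \<theta>) (Arg b) * cnj (of_real (cos \<theta>))) = rcis (2 * (sin \<theta> * cos \<theta>)) (Arg b)"
    by (simp add: rcis_def)
  ultimately have "2 * (rcis (sin \<theta>) (Arg b) * cnj (of_real (cos \<theta>))) = b"
    by (simp only: rcis_cmod_Arg)
  then show ?thesis
    using that[of "of_real (cos \<theta>)" "rcis (sin \<theta>) (Arg b)"] by simp
qed

text \<open>A diagonal unitary matrix with the eigenvalues \<open>x\<close>, \<open>y\<close>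
  determined by \<open>(s, p)\<close> is conjugated by \<open>SU(2)\<close>; hence both frames agree
  and the lower left entry is \<open>(x - y) * (d * cnj c)\<close>. As
  \<open>2 * (d * cnj c)\<close> takes every value in the closed unit disc, this entry fills the
  disc of radius \<open>cmod (x - y) / 2\<close>, which is \<open>R\<close>.\<close>

lemma slice_svd_point:
  assumes "(cmod a)\<^sup>2 + (cmod s)\<^sup>2 / 4 \<le> 1" "s = cnj s * p" "cmod p = 1"
  obtains c d x y where "(cmod c)\<^sup>2 + (cmod d)\<^sup>2 = 1" "cmod x = 1" "cmod y = 1"
    "(a, s, p) = svd_point c d c d x y"
proof -
  have "(cmod s)\<^sup>2 \<le> 4" using assms(1) zero_le_power2[of "cmod a"] by linarith
  then have "cmod s \<le> 2" using power2_le_imp_le[of "cmod s" 2] by simp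
  then obtain \<eta> t where \<eta>: "cmod \<eta> = 1" "\<eta>\<^sup>2 = p" "s = \<eta> * of_real t" "\<bar>t\<bar> \<le> 2"
    using symmetrized_torus assms by metis
  define R where "R = sqrt (1 - t\<^sup>2 / 4)"
  have t2: "t\<^sup>2 \<le> 4" using \<eta>(4) abs_le_square_iff[of t 2] by simp
  have R: "R \<ge> 0" "R\<^sup>2 = 1 - t\<^sup>2 / 4" using t2 by (auto simp: R_def)
  have "(cmod a)\<^sup>2 \<le> R\<^sup>2" using assms(1) \<eta> R by (simp add: norm_mult)
  then have aR: "cmod a \<le> R" using power2_le_imp_le R(1) by blast
  \<comment> \<open>The factor of \<open>b\<close> is \<open>(x - y) / 2\<close> for the eigenvalues
    chosen below; when it vanishes so does \<open>a\<close>, and \<open>0\<close> serves.\<close>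
  obtain b where b: "cmod b \<le> 1" "\<i> * \<eta> * R * b = a"
  proof (cases "R = 0")
    case True
    then show ?thesis using aR by (intro that[of 0]) auto
  next
    case False
    have k: "cmod (\<i> * \<eta> * R) = R" using R(1) \<eta>(1) by (simp add: norm_mult)
    then have "\<i> * \<eta> * R \<noteq> 0" using False by (metis norm_zero)
    then have "\<i> * \<eta> * R * (a / (\<i> * \<eta> * R)) = a" by simp
    moreover have "cmod (a / (\<i> * \<eta> * R)) \<le> 1"
      unfolding norm_divide k using aR R(1) False by simp
    ultimately show ?thesis using that by blast
  qed
  obtain c d where cd: "(cmod c)\<^sup>2 + (cmod d)\<^sup>2 = 1" "2 * (d * cnj c) = b"
    using obtain_double_angle b by metis
  \<comment> \<open>The roots of \<open>z\<^sup>2 - s * z + p\<close>: a conjugate pair on the unit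
    circle, rotated by \<open>\<eta>\<close>.\<close>
  define x y where "x = \<eta> * Complex (t / 2) R" and "y = \<eta> * Complex (t / 2) (- R)"
  have "cmod x = 1" "cmod y = 1"
    using R \<eta> by (simp_all add: x_def y_def norm_mult complex_norm power_divide)
  moreover have "x * y = p" "x + y = s" "x - y = 2 * \<i> * \<eta> * R"
  proof -
    have "Complex (t / 2) R * Complex (t / 2) (- R) = of_real (t\<^sup>2 / 4 + R\<^sup>2)"
      by (simp add: complex_eq_iff power2_eq_square)
    then have "Complex (t / 2) R * Complex (t / 2) (- R) = 1" using R by simp
    then show "x * y = p" unfolding x_def y_def \<eta>(2)[symmetric] by algebra
    have "Complex (t / 2) R + Complex (t / 2) (- R) = of_real t"
      by (simp add: complex_eq_iff)
    then show "x + y = s" unfolding x_def y_def \<eta>(3) distrib_left[symmetric] by simp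
    have "Complex (t / 2) R - Complex (t / 2) (- R) = 2 * \<i> * R"
      by (simp add: complex_eq_iff)
    then show "x - y = 2 * \<i> * \<eta> * R"
      unfolding x_def y_def right_diff_distrib[symmetric] by simp
  qed
  moreover have "svd_point c d c d x y = ((x - y) * (d * cnj c), (x + y) * (c * cnj c + d * cnj d), x * y)"
    by (simp add: svd_point_def algebra_simps)
  moreover have "c * cnj c + d * cnj d = 1" using cd cmod2_sum_eq_1_iff by simp
  moreover have "(2 * \<i> * \<eta> * R) * (d * cnj c) = a"
    using b(2) unfolding cd(2)[symmetric] by (simp add: algebra_simps)
  ultimately show ?thesis using that[OF cd(1), of x y] by simp
qed

lemma dilate_slice_in_pentablock:
  assumes "(cmod a)\<^sup>2 + (cmod s)\<^sup>2 / 4 \<le> 1" "s = cnj s * p" "cmod p = 1" "0 \<le> r" "r < 1"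
  shows "dilate r (a, s, p) \<in> pentablock"
proof -
  obtain c d x y where *: "(cmod c)\<^sup>2 + (cmod d)\<^sup>2 = 1" "cmod x = 1" "cmod y = 1"
    "(a, s, p) = svd_point c d c d x y"
    using slice_svd_point assms(1-3) by blast
  show ?thesis
    unfolding * dilate_svd_point using * assms by (intro svd_point_in_pentablock) (auto simp: norm_mult)
qed

lemma dilate_pentablock:
  assumes "w \<in> pentablock" "0 \<le> r" "r < 1"
  shows "dilate r w \<in> pentablock"
proof -
  obtain p q e f x y where *:
    "(cmod p)\<^sup>2 + (cmod q)\<^sup>2 = 1" "(cmod e)\<^sup>2 + (cmod f)\<^sup>2 = 1" "cmod x < 1" "cmod y < 1"
    "w = svd_point p q e f x y"
    using assms(1) pentablock_svd_point by blast
  have "r * cmod z < 1" if "cmod z < 1" for z using mult_strict_mono[of r 1 "cmod z" 1] assms that by simp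
  then show ?thesis
    unfolding * dilate_svd_point using * assms by (intro svd_point_in_pentablock) (auto simp: norm_mult)
qed

lemma tendsto_dilate: "((\<lambda>r. dilate r w) \<longlongrightarrow> w) (at_left 1)"
proof -
  obtain a s p where w: "w = (a, s, p)" by (metis prod_cases3)
  have "((\<lambda>r. dilate r w) \<longlongrightarrow> (of_real 1 * a, of_real 1 * s, (of_real 1)\<^sup>2 * p)) (at_left 1)"
    unfolding dilate_def w case_prod_conv by (intro tendsto_intros)
  then show ?thesis by (simp add: w)
qed

text \<open>Dilates with \<open>r < 1\<close> lie in the open pentablock and converge as
  \<open>r\<close> tends to one.\<close>

lemma penta_torus_subset: "penta_torus \<subseteq> closure pentablock"
proof
  fix w assume "w \<in> penta_torus"
  then have "\<forall>\<^sub>F r in at_left 1. dilate r w \<in> closure pentablock"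
    unfolding eventually_at_left_field penta_torus_def
    by (intro exI[of _ 0]) (auto intro!: closure_subset[THEN subsetD] dilate_slice_in_pentablock)
  then show "w \<in> closure pentablock"
    by (intro Lim_in_closed_set[OF closed_closure _ _ tendsto_dilate]) auto
qed

lemma closed_penta_torus: "closed penta_torus"
  unfolding penta_torus_def case_prod_unfold
  by (intro closed_Collect_conj closed_Collect_eq continuous_intros) auto

lemma closure_pentablock_bounds:
  assumes "(a, s, p) \<in> closure pentablock"
  shows "(cmod a)\<^sup>2 + (cmod s)\<^sup>2 / 4 \<le> 1" "cmod p \<le> 1"
proof -
  let ?S = "{(a, s, p). (cmod a)\<^sup>2 + (cmod s)\<^sup>2 / 4 \<le> 1 \<and> cmod p \<le> 1}"
  have "closed ?S"
    unfolding case_prod_unfold by (intro closed_Collect_conj closed_Collect_le continuous_intros) auto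
  moreover have "pentablock \<subseteq> ?S"
  proof clarify
    fix a s p assume "(a, s, p) \<in> pentablock"
    then obtain c d e f x y where
      "(cmod c)\<^sup>2 + (cmod d)\<^sup>2 = 1" "(cmod e)\<^sup>2 + (cmod f)\<^sup>2 = 1" "cmod x < 1" "cmod y < 1"
      "(a, s, p) = svd_point c d e f x y"
      by (rule pentablock_svd_point)
    then show "(cmod a)\<^sup>2 + (cmod s)\<^sup>2 / 4 \<le> 1 \<and> cmod p \<le> 1"
      using svd_point_bounds[of c d e f x y a s p] by simp
  qed
  ultimately show "(cmod a)\<^sup>2 + (cmod s)\<^sup>2 / 4 \<le> 1" "cmod p \<le> 1"
    using assms closure_minimal[of pentablock ?S] by auto
qed

lemma compact_closure_pentablock: "compact (closure pentablock)"
proof -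
  have "norm w \<le> 4" if "w \<in> closure pentablock" for w
  proof -
    obtain a s p where w: "w = (a, s, p)" by (metis prod_cases3)
    note b = closure_pentablock_bounds[OF that[unfolded w]]
    have "(cmod a)\<^sup>2 \<le> 1" "(cmod s)\<^sup>2 \<le> 4"
      using b(1) zero_le_power2[of "cmod a"] zero_le_power2[of "cmod s"] by linarith+
    then have "cmod a \<le> 1" "cmod s \<le> 2"
      using power2_le_imp_le[of "cmod a" 1] power2_le_imp_le[of "cmod s" 2] by simp_all
    moreover have "norm w \<le> cmod a + (cmod s + cmod p)"
      unfolding w using norm_Pair_le[of a "(s, p)"] norm_Pair_le[of s p] by linarith
    ultimately show ?thesis using b(2) by linarith
  qed
  then show ?thesis
    unfolding compact_eq_bounded_closed bounded_iff by (intro conjI exI[of _ 4] ballI closed_closure)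
qed

section \<open>The maximum principle along analytic discs\<close>

text \<open>Complex-linearity of the derivative of \<open>F\<close> makes the chain rule yield
  multiplication by \<open>c1 * d1 + c2 * d2 + c3 * d3\<close>.\<close>

lemma holomorphic3_on_compose:
  assumes "holomorphic3_on F \<Omega>" "g1 holomorphic_on S" "g2 holomorphic_on S" "g3 holomorphic_on S"
    "\<And>z. z \<in> S \<Longrightarrow> (g1 z, g2 z, g3 z) \<in> \<Omega>"
  shows "(\<lambda>z. F (g1 z, g2 z, g3 z)) holomorphic_on S"
  unfolding holomorphic_on_def field_differentiable_def
proof
  fix z assume z: "z \<in> S"
  obtain d1 d2 d3 where d: "(g1 has_field_derivative d1) (at z within S)"
    "(g2 has_field_derivative d2) (at z within S)" "(g3 has_field_derivative d3) (at z within S)"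
    using assms(2-4) z unfolding holomorphic_on_def field_differentiable_def by blast
  let ?g = "\<lambda>z. (g1 z, g2 z, g3 z)"
  obtain c1 c2 c3 where c: "(F has_derivative (\<lambda>(x, y, z). c1 * x + c2 * y + c3 * z)) (at (?g z) within \<Omega>)"
    using assms(1,5) z unfolding holomorphic3_on_def by blast
  have "(?g has_derivative (\<lambda>h. (d1 * h, d2 * h, d3 * h))) (at z within S)"
    using d unfolding has_field_derivative_def by (intro has_derivative_Pair)
  moreover have "(F has_derivative (\<lambda>(x, y, z). c1 * x + c2 * y + c3 * z)) (at (?g z) within ?g ` S)"
    by (rule has_derivative_subset[OF c]) (use assms(5) in blast)
  ultimately have "((\<lambda>z. F (?g z)) has_derivative
      (\<lambda>h. (\<lambda>(x, y, z). c1 * x + c2 * y + c3 * z) (d1 * h, d2 * h, d3 * h))) (at z within S)"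
    by (rule has_derivative_in_compose)
  then have "((\<lambda>z. F (?g z)) has_field_derivative (c1 * d1 + c2 * d2 + c3 * d3)) (at z within S)"
    unfolding has_field_derivative_def by (rule has_derivative_eq_rhs) (simp add: fun_eq_iff algebra_simps)
  then show "\<exists>f'. ((\<lambda>z. F (?g z)) has_field_derivative f') (at z within S)" by blast
qed

text \<open>Maximum modulus along an analytic disc. The image of the closed disc stays inside
  \<open>\<Omega>\<close>, which the dilations below arrange.\<close>

lemma boundary_algebra_disc_maximum:
  assumes F: "F \<in> boundary_algebra \<Omega>" and R: "R > 0"
    and hol: "g holomorphic_on ball 0 R" "h holomorphic_on ball 0 R" "k holomorphic_on ball 0 R"
    and cont: "continuous_on (cball 0 R) g" "continuous_on (cball 0 R) h" "continuous_on (cball 0 R) k"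
    and in_\<Omega>: "\<And>z. z \<in> cball 0 R \<Longrightarrow> (g z, h z, k z) \<in> \<Omega>"
    and le: "\<And>z. cmod z = R \<Longrightarrow> cmod (F (g z, h z, k z)) \<le> B"
    and z: "cmod z \<le> R"
  shows "cmod (F (g z, h z, k z)) \<le> B"
proof (rule maximum_modulus_frontier[where S = "cball 0 R" and f = "\<lambda>z. F (g z, h z, k z)"])
  show "(\<lambda>z. F (g z, h z, k z)) holomorphic_on interior (cball 0 R)"
    using F hol in_\<Omega> unfolding boundary_algebra_def interior_cball
    by (intro holomorphic3_on_compose[of F \<Omega>]) auto
  have "continuous_on (cball 0 R) (\<lambda>z. (g z, h z, k z))"
    using cont by (intro continuous_intros)
  then show "continuous_on (closure (cball 0 R)) (\<lambda>z. F (g z, h z, k z))"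
    using F in_\<Omega> closure_subset[of \<Omega>] unfolding boundary_algebra_def
    by (auto intro!: continuous_on_compose2[of "closure \<Omega>" F])
qed (use R z le in auto)

text \<open>On the unit circle the numerator is \<open>z\<close> times the conjugate of the
  denominator; the maximum principle handles the interior. The value at \<open>0\<close> puts a
  given singular value at the centre of a disc.\<close>

lemma mobius_disc:
  assumes "cmod \<sigma> < 1"
  defines "m \<equiv> \<lambda>z. (z + \<sigma>) / (1 + cnj \<sigma> * z)"
  shows "m holomorphic_on ball 0 1" "continuous_on (cball 0 1) m"
    "\<And>z. cmod z = 1 \<Longrightarrow> cmod (m z) = 1" "\<And>z. cmod z \<le> 1 \<Longrightarrow> cmod (m z) \<le> 1" "m 0 = \<sigma>"
proof -
  have nz: "1 + cnj \<sigma> * z \<noteq> 0" if "cmod z \<le> 1" for z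
  proof
    assume "1 + cnj \<sigma> * z = 0"
    then have "cmod (cnj \<sigma> * z) = 1" by (metis add_eq_0_iff norm_minus_cancel norm_one)
    moreover have "cmod \<sigma> * cmod z < 1"
      using mult_left_mono[OF that, of "cmod \<sigma>"] assms(1) by simp
    ultimately show False by (simp add: norm_mult)
  qed
  show "m holomorphic_on ball 0 1"
    unfolding m_def by (intro holomorphic_intros) (auto simp: nz)
  show "continuous_on (cball 0 1) m"
    unfolding m_def by (intro continuous_intros) (auto simp: nz)
  show 1: "cmod (m z) = 1" if "cmod z = 1" for z
  proof -
    have "z * cnj z = 1" using cmod2_eq[of z] that by simp
    then have "z + \<sigma> = z * cnj (1 + cnj \<sigma> * z)" by (simp, algebra)
    then have "cmod (z + \<sigma>) = cmod z * cmod (1 + cnj \<sigma> * z)" by (metis complex_mod_cnj norm_mult)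
    then show ?thesis using nz[of z] that by (simp add: m_def norm_divide)
  qed
  show "cmod (m z) \<le> 1" if "cmod z \<le> 1" for z
    by (rule maximum_modulus_frontier[where S = "cball 0 1"])
       (use 1 that \<open>m holomorphic_on ball 0 1\<close> \<open>continuous_on (cball 0 1) m\<close> in auto)
  show "m 0 = \<sigma>" by (simp add: m_def)
qed

text \<open>Dilating by \<open>r < 1\<close> moves the slice into the open pentablock, where \<open>F\<close> is holomorphic.\<close>

lemma dilate_torus_dominates_slice:
  assumes F: "F \<in> boundary_algebra pentablock" and r: "0 \<le> r" "r < 1"
    and B: "\<And>w. w \<in> penta_torus \<Longrightarrow> cmod (F (dilate r w)) \<le> B"
    and a: "(cmod a)\<^sup>2 + (cmod s)\<^sup>2 / 4 \<le> 1" and sp: "s = cnj s * p" "cmod p = 1"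
  shows "cmod (F (dilate r (a, s, p))) \<le> B"
proof -
  \<comment> \<open>Radius of the disc of admissible \<open>a\<close> over \<open>(s, p)\<close>;
    when it is zero, the slice is a single point of \<open>penta_torus\<close>.\<close>
  define R where "R = sqrt (1 - (cmod s)\<^sup>2 / 4)"
  have s: "(cmod s)\<^sup>2 / 4 \<le> 1" using a zero_le_power2[of "cmod a"] by linarith
  have R: "R \<ge> 0" "R\<^sup>2 = 1 - (cmod s)\<^sup>2 / 4" using s by (auto simp: R_def)
  have iff: "(cmod z)\<^sup>2 + (cmod s)\<^sup>2 / 4 \<le> 1 \<longleftrightarrow> cmod z \<le> R" "(cmod z)\<^sup>2 + (cmod s)\<^sup>2 / 4 = 1 \<longleftrightarrow> cmod z = R" for z
    using R power2_le_iff_abs_le[of R "cmod z"] power2_eq_iff_nonneg[of "cmod z" R] by auto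
  show ?thesis
  proof (cases "R = 0")
    case True
    then have "(a, s, p) \<in> penta_torus" using a sp iff[of a] by (simp add: penta_torus_def)
    then show ?thesis by (rule B)
  next
    case False
    have "cmod (F (of_real r * a, of_real r * s, (of_real r)\<^sup>2 * p)) \<le> B"
    proof (rule boundary_algebra_disc_maximum[OF F, where g = "\<lambda>a. of_real r * a" and z = a
        and h = "\<lambda>_. of_real r * s" and k = "\<lambda>_. (of_real r)\<^sup>2 * p" and R = R])
      show "(of_real r * z, of_real r * s, (of_real r)\<^sup>2 * p) \<in> pentablock" if "z \<in> cball 0 R" for z
        using dilate_slice_in_pentablock[OF _ sp r, of z] that iff by (simp add: dilate_def)
      show "cmod (F (of_real r * z, of_real r * s, (of_real r)\<^sup>2 * p)) \<le> B" if "cmod z = R" for z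
      proof -
        have "(cmod z)\<^sup>2 + (cmod s)\<^sup>2 / 4 = 1" using that iff(2) by blast
        then have "(z, s, p) \<in> penta_torus" using sp by (simp add: penta_torus_def)
        from B[OF this] show ?thesis by (simp add: dilate_def)
      qed
    qed (use False R a iff in \<open>auto intro!: holomorphic_intros continuous_intros\<close>)
    then show ?thesis by (simp add: dilate_def)
  qed
qed

text \<open>With the unitary factors of \<open>w\<close> fixed, \<open>x\<close> and
  \<open>y\<close> move along Moebius maps. The resulting disc passes through \<open>w\<close> at
  \<open>0\<close>, and its boundary values come from unitary matrices, where the slice estimate
  applies.\<close>

lemma dilate_torus_dominates:
  assumes F: "F \<in> boundary_algebra pentablock" and r: "0 \<le> r" "r < 1"
    and B: "\<And>w. w \<in> penta_torus \<Longrightarrow> cmod (F (dilate r w)) \<le> B"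
    and w: "w \<in> pentablock"
  shows "cmod (F (dilate r w)) \<le> B"
proof -
  obtain p q e f x y where *:
    "(cmod p)\<^sup>2 + (cmod q)\<^sup>2 = 1" "(cmod e)\<^sup>2 + (cmod f)\<^sup>2 = 1" "cmod x < 1" "cmod y < 1"
    "w = svd_point p q e f x y"
    using w pentablock_svd_point by blast
  define m where "m \<sigma> z = (z + \<sigma>) / (1 + cnj \<sigma> * z)" for \<sigma> z
  note m = mobius_disc[OF *(3), folded m_def] mobius_disc[OF *(4), folded m_def]
  define g where "g z = dilate r (svd_point p q e f (m x z) (m y z))" for z
  define g1 where "g1 = (\<lambda>z. of_real r * (m x z * (q * cnj e) - m y z * (cnj p * f)))"
  define g2 where "g2 = (\<lambda>z. of_real r * (m x z * (p * cnj e + q * cnj f) + m y z * (cnj p * e + cnj q * f)))"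
  define g3 where "g3 = (\<lambda>z. (of_real r)\<^sup>2 * (m x z * m y z))"
  have g: "(g1 z, g2 z, g3 z) = g z" for z
    by (simp add: g_def g1_def g2_def g3_def dilate_def svd_point_def)
  have r': "r * cmod z < 1" if "cmod z \<le> 1" for z
    using mult_left_mono[OF that, of r] r by simp
  have "cmod (F (g1 0, g2 0, g3 0)) \<le> B"
  proof (rule boundary_algebra_disc_maximum[OF F, where R = 1 and g = g1 and h = g2 and k = g3 and z = 0])
    show "g1 holomorphic_on ball 0 1" "g2 holomorphic_on ball 0 1" "g3 holomorphic_on ball 0 1"
      unfolding g1_def g2_def g3_def by (intro holomorphic_intros m(1,6))+
    show "continuous_on (cball 0 1) g1" "continuous_on (cball 0 1) g2" "continuous_on (cball 0 1) g3"
      unfolding g1_def g2_def g3_def by (intro continuous_intros m(2,7))+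
    show "(g1 z, g2 z, g3 z) \<in> pentablock" if "z \<in> cball 0 1" for z
    proof -
      have "cmod (of_real r * m x z) < 1" "cmod (of_real r * m y z) < 1"
        using r' m(4)[of z] m(9)[of z] that r(1) by (simp_all add: norm_mult)
      then show ?thesis
        unfolding g unfolding g_def dilate_svd_point by (rule svd_point_in_pentablock[OF *(1,2)])
    qed
    show "cmod (F (g1 z, g2 z, g3 z)) \<le> B" if "cmod z = 1" for z
    proof -
      obtain a s t where sv: "svd_point p q e f (m x z) (m y z) = (a, s, t)" by (metis prod_cases3)
      have mz: "cmod (m x z) = 1" "cmod (m y z) = 1" using m that by auto
      show ?thesis
        unfolding g unfolding g_def sv
      proof (rule dilate_torus_dominates_slice[OF F r B])
        show "(cmod a)\<^sup>2 + (cmod s)\<^sup>2 / 4 \<le> 1"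
          using svd_point_bounds(1)[OF *(1,2) _ _ sv] mz by linarith
      qed (assumption | rule svd_point_unitary[OF mz sv])+
    qed
  qed auto
  then show ?thesis unfolding g by (simp add: g_def m(5,10) *(5))
qed

text \<open>The estimate for dilates passes to \<open>r\<close> near one: by uniform continuity on
  the compact closure, dilating changes \<open>F\<close> by less than \<open>\<epsilon> / 2\<close>,
  once on the torus and once at \<open>w\<close>.\<close>

lemma is_boundary_penta_torus: "is_boundary pentablock penta_torus"
  unfolding is_boundary_def
proof (intro conjI ballI)
  show "penta_torus \<subseteq> closure pentablock" by (rule penta_torus_subset)
  fix F assume F: "F \<in> boundary_algebra pentablock"
  let ?C = "closure pentablock"
  have cont: "continuous_on ?C F" using F by (simp add: boundary_algebra_def)
  have "compact penta_torus"
    using compact_Int_closed[OF compact_closure_pentablock closed_penta_torus] penta_torus_subset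
    by (simp add: Int_absorb1)
  moreover have "(0, 2, 1) \<in> penta_torus" by (simp add: penta_torus_def)
  moreover have "continuous_on penta_torus (\<lambda>w. cmod (F w))"
    using continuous_on_subset[OF cont penta_torus_subset] by (intro continuous_intros)
  ultimately obtain k where k: "k \<in> penta_torus" "\<And>w. w \<in> penta_torus \<Longrightarrow> cmod (F w) \<le> cmod (F k)"
    using continuous_attains_sup[of penta_torus "\<lambda>w. cmod (F w)"] by blast
  have "cmod (F w) \<le> cmod (F k)" if w: "w \<in> pentablock" for w
  proof (rule field_le_epsilon)
    fix \<epsilon> :: real assume \<epsilon>: "\<epsilon> > 0"
    have "uniformly_continuous_on ?C F" using cont compact_closure_pentablock compact_uniformly_continuous by blast
    then obtain \<delta> where \<delta>: "\<delta> > 0"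
      "\<And>w w'. w \<in> ?C \<Longrightarrow> w' \<in> ?C \<Longrightarrow> dist w' w < \<delta> \<Longrightarrow> dist (F w') (F w) < \<epsilon> / 2"
      unfolding uniformly_continuous_on_def using \<epsilon> by (metis half_gt_zero)
    obtain b where b: "\<And>w. w \<in> ?C \<Longrightarrow> norm w \<le> b" "b > 0"
      using compact_closure_pentablock[THEN compact_imp_bounded] bounded_pos by blast
    obtain r where r: "0 \<le> r" "r < 1" "(1 - r) * (4 * b) < \<delta>"
    proof
      \<comment> \<open>The cap at zero keeps \<open>r\<close> nonnegative; \<open>8\<close> in
        place of \<open>4\<close> makes the last inequality strict.\<close>
      show "max 0 (1 - \<delta> / (8 * b)) < 1" "0 \<le> max 0 (1 - \<delta> / (8 * b))" using b \<delta> by auto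
      have "(1 - max 0 (1 - \<delta> / (8 * b))) * (4 * b) \<le> \<delta> / (8 * b) * (4 * b)"
        using b by (intro mult_right_mono) auto
      also have "\<dots> < \<delta>" using b \<delta> by simp
      finally show "(1 - max 0 (1 - \<delta> / (8 * b))) * (4 * b) < \<delta>" .
    qed
    \<comment> \<open>The coordinates move by at most \<open>(1 - r) * b\<close>,
      \<open>(1 - r) * b\<close> and \<open>2 * (1 - r) * b\<close>, the last because
      \<open>1 - r\<^sup>2 \<le> 2 * (1 - r)\<close>.\<close>
    have dist: "dist (dilate r w) w < \<delta>" if "w \<in> ?C" for w
    proof -
      obtain a s p where w: "w = (a, s, p)" by (metis prod_cases3)
      have n: "cmod a \<le> b" "cmod s \<le> b" "cmod p \<le> b"
        using b(1)[OF that] norm_fst_le[of a "(s, p)"] norm_snd_le[of "(s, p)" a]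
          norm_fst_le[of s p] norm_snd_le[of p s]
        by (auto simp: w)
      have "dist (dilate r w) w \<le> cmod (r * a - a) + (cmod (r * s - s) + cmod (r\<^sup>2 * p - p))"
        unfolding w dist_norm dilate_def
        using norm_Pair_le[of "r * a - a" "(r * s - s, r\<^sup>2 * p - p)"] norm_Pair_le[of "r * s - s" "r\<^sup>2 * p - p"]
        by simp
      moreover have e: "cmod (r * z - z) = (1 - r) * cmod z" "cmod (r\<^sup>2 * z - z) = (1 - r\<^sup>2) * cmod z" for z :: complex
      proof -
        have "r * z - z = of_real (r - 1) * z" "r\<^sup>2 * z - z = of_real (r\<^sup>2 - 1) * z" by (simp_all add: algebra_simps)
        moreover have "\<bar>r\<^sup>2 - 1\<bar> = 1 - r\<^sup>2" "\<bar>r - 1\<bar> = 1 - r" using r by (auto simp: abs_square_le_1 power_le_one)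
        ultimately show "cmod (r * z - z) = (1 - r) * cmod z" "cmod (r\<^sup>2 * z - z) = (1 - r\<^sup>2) * cmod z"
          by (simp_all only: norm_mult norm_of_real)
      qed
      moreover have "1 - r\<^sup>2 \<le> (1 - r) * 2"
        using sum_power2_ge_zero[of "1 - r" 0] by (simp add: power2_eq_square algebra_simps)
      then have "(1 - r\<^sup>2) * cmod p \<le> (1 - r) * 2 * b" using n r b by (intro mult_mono) auto
      moreover have "(1 - r) * cmod a \<le> (1 - r) * b" "(1 - r) * cmod s \<le> (1 - r) * b"
        using n r by (auto intro: mult_left_mono)
      ultimately have "dist (dilate r w) w \<le> (1 - r) * b + ((1 - r) * b + (1 - r) * 2 * b)"
        unfolding e by linarith
      also have "\<dots> = (1 - r) * (4 * b)" by (simp add: algebra_simps)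
      finally show ?thesis using r(3) by simp
    qed
    have near: "cmod (F (dilate r w) - F w) < \<epsilon> / 2" if "w \<in> ?C" "dilate r w \<in> ?C" for w
      using \<delta>(2)[OF that(1,2) dist[OF that(1)]] by (simp add: dist_norm)
    have "cmod (F (dilate r w)) \<le> cmod (F k) + \<epsilon> / 2"
    proof (rule dilate_torus_dominates[OF F r(1,2) _ w])
      fix v assume v: "v \<in> penta_torus"
      then have "dilate r v \<in> ?C"
        using r closure_subset unfolding penta_torus_def
        by (auto intro!: closure_subset[THEN subsetD] dilate_slice_in_pentablock)
      then have "cmod (F (dilate r v) - F v) < \<epsilon> / 2" using near v penta_torus_subset by blast
      then show "cmod (F (dilate r v)) \<le> cmod (F k) + \<epsilon> / 2"
        using k(2)[OF v] norm_triangle_sub[of "F (dilate r v)" "F v"] by linarith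
    qed
    moreover have "cmod (F (dilate r w) - F w) < \<epsilon> / 2"
      using near w dilate_pentablock[OF w r(1,2)] closure_subset by blast
    ultimately show "cmod (F w) \<le> cmod (F k) + \<epsilon>"
      using norm_triangle_sub[of "F w" "F (dilate r w)"] norm_minus_commute[of "F w"] by fastforce
  qed
  then have "\<forall>w'\<in>?C. cmod (F w') \<le> cmod (F k)"
    using continuous_on_closure_norm_le[OF cont] by blast
  then show "\<exists>w\<in>penta_torus. \<forall>w'\<in>?C. cmod (F w') \<le> cmod (F w)" using k by blast
qed

section \<open>Peak functions and minimality\<close>

text \<open>Both factors of \<open>F\<close> have modulus at most two on the closure, and
  \<open>F w0 = 4\<close>. A maximum point therefore has both factors extremal, and the equality
  case of Cauchy-Schwarz identifies it with \<open>w0\<close>.\<close>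

lemma penta_torus_minimal:
  assumes "is_boundary pentablock B"
  shows "penta_torus \<subseteq> B"
proof
  fix w0 assume w0: "w0 \<in> penta_torus"
  obtain a0 s0 p0 where w0_eq: "w0 = (a0, s0, p0)" by (metis prod_cases3)
  have K: "(cmod a0)\<^sup>2 + (cmod s0)\<^sup>2 / 4 = 1" "cmod p0 = 1"
    using w0 by (auto simp: w0_eq penta_torus_def)
  \<comment> \<open>The inner product with \<open>(a0, s0)\<close> belonging to the norm square
    \<open>(cmod a)\<^sup>2 + (cmod s)\<^sup>2 / 4\<close>.\<close>
  define l where "l = (\<lambda>(a, s, p :: complex). cnj a0 * a + cnj s0 * s / 4)"
  define F where "F = (\<lambda>(a, s, p). (1 + l (a, s, p)) * (1 + cnj p0 * p))"
  have "F \<in> boundary_algebra pentablock"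
    unfolding boundary_algebra_def holomorphic3_on_def
  proof (intro CollectI conjI ballI)
    show "continuous_on (closure pentablock) F"
      unfolding F_def l_def case_prod_unfold by (intro continuous_intros) auto
    fix w :: complex3 assume "w \<in> pentablock"
    obtain a s p where w: "w = (a, s, p)" by (metis prod_cases3)
    have "((\<lambda>w :: complex3. 1 + (cnj a0 * fst w + cnj s0 * fst (snd w) / 4)) has_derivative
        (\<lambda>w. cnj a0 * fst w + cnj s0 * fst (snd w) / 4)) (at w within pentablock)"
      "((\<lambda>w :: complex3. 1 + cnj p0 * snd (snd w)) has_derivative (\<lambda>w. cnj p0 * snd (snd w))) (at w within pentablock)"
      by (auto intro!: derivative_eq_intros)
    from has_derivative_mult[OF this]
    have "(F has_derivative (\<lambda>(x, y, z). cnj a0 * (1 + cnj p0 * p) * x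
        + cnj s0 / 4 * (1 + cnj p0 * p) * y + (1 + l (a, s, p)) * cnj p0 * z)) (at w within pentablock)"
      unfolding F_def l_def case_prod_unfold fst_conv snd_conv
      by (rule has_derivative_eq_rhs) (simp add: fun_eq_iff w algebra_simps add_divide_distrib)
    then show "\<exists>c1 c2 c3. (F has_derivative (\<lambda>(x, y, z). c1 * x + c2 * y + c3 * z)) (at w within pentablock)"
      by blast
  qed
  then obtain w where w: "w \<in> B" "\<And>w'. w' \<in> closure pentablock \<Longrightarrow> cmod (F w') \<le> cmod (F w)"
    using assms by (auto simp: is_boundary_def)
  obtain a s p where w_eq: "w = (a, s, p)" by (metis prod_cases3)
  have "w \<in> closure pentablock" using assms w by (auto simp: is_boundary_def)
  then have b: "(cmod a)\<^sup>2 + (cmod s)\<^sup>2 / 4 \<le> 1" "cmod p \<le> 1"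
    using closure_pentablock_bounds by (auto simp: w_eq)
  have "F w0 = 4"
  proof -
    have "l w0 = of_real ((cmod a0)\<^sup>2 + (cmod s0)\<^sup>2 / 4)"
      unfolding of_real_add of_real_divide cmod2_eq by (simp add: l_def w0_eq mult.commute)
    moreover have "cnj p0 * p0 = 1" using cmod2_eq[of p0] K by (simp add: mult.commute)
    ultimately show ?thesis using K by (simp add: F_def w0_eq)
  qed
  then have ge: "4 \<le> cmod (1 + l w) * cmod (1 + cnj p0 * p)"
    using w(2)[of w0] w0 penta_torus_subset by (auto simp: F_def w_eq norm_mult)
  have sq: "(cmod (z - z0))\<^sup>2 = (cmod z)\<^sup>2 + (cmod z0)\<^sup>2 - 2 * Re (cnj z0 * z)" for z z0
    unfolding cmod_power2 by (simp add: power2_eq_square algebra_simps)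
  \<comment> \<open>The squared distance from \<open>(a, s)\<close> to \<open>(a0, s0)\<close>,
    expanded; once \<open>l w = 1\<close>, the left side is at most zero.\<close>
  have gap: "(cmod a)\<^sup>2 + (cmod s)\<^sup>2 / 4 + 1 - 2 * Re (l w) = (cmod (a - a0))\<^sup>2 + (cmod (s - s0))\<^sup>2 / 4"
    using K(1) unfolding sq l_def w_eq by (simp add: field_simps)
  have "cmod (l w) \<le> 1"
  proof -
    have "cmod (l w) \<le> cmod a0 * cmod a + cmod s0 * cmod s / 4"
      unfolding l_def w_eq using norm_triangle_ineq[of "cnj a0 * a" "cnj s0 * s / 4"] by (simp add: norm_mult)
    moreover have "2 * (cmod a0 * cmod a) \<le> (cmod a0)\<^sup>2 + (cmod a)\<^sup>2" "2 * (cmod s0 * cmod s) \<le> (cmod s0)\<^sup>2 + (cmod s)\<^sup>2"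
      using sum_squares_bound[of "cmod a0" "cmod a"] sum_squares_bound[of "cmod s0" "cmod s"] by (auto simp: mult.assoc)
    ultimately show ?thesis using b K by linarith
  qed
  moreover have "cmod (cnj p0 * p) \<le> 1" using K b by (simp add: norm_mult)
  \<comment> \<open>Only \<open>1\<close> in the closed unit disc has distance two from
    \<open>- 1\<close>.\<close>
  moreover have *: "z = 1" if "cmod z \<le> 1" "cmod (1 + z) \<ge> 2" for z
  proof -
    have "(cmod (1 + z))\<^sup>2 = 1 + (cmod z)\<^sup>2 + 2 * Re z"
      unfolding cmod_power2 by (simp add: power2_eq_square algebra_simps)
    moreover have "2\<^sup>2 \<le> (cmod (1 + z))\<^sup>2" using that by (intro power_mono) auto
    moreover have "(cmod z)\<^sup>2 \<le> 1" using that by (simp add: power_le_one)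
    ultimately have 1: "Re z \<ge> 1" by simp
    have "Re z \<le> 1" using complex_Re_le_cmod[of z] that by simp
    with 1 have "Re z = 1" by simp
    moreover from this have "Im z = 0" using \<open>(cmod z)\<^sup>2 \<le> 1\<close> by (simp add: cmod_power2)
    ultimately show ?thesis by (simp add: complex_eq_iff)
  qed
  moreover have "cmod (1 + z) \<le> 2" if "cmod z \<le> 1" for z using norm_triangle_ineq[of 1 z] that by simp
  moreover have "x \<ge> 2 \<and> y \<ge> 2" if "4 \<le> x * y" "x \<le> 2" "y \<le> 2" "x \<ge> 0" "y \<ge> 0" for x y :: real
    using that mult_left_mono[of y 2 x] mult_right_mono[of x 2 y] by linarith
  ultimately have "l w = 1" "cnj p0 * p = 1" using ge by (metis norm_ge_zero)+
  have "p0 * (cnj p0 * p) = p0" using \<open>cnj p0 * p = 1\<close> by simp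
  moreover have "p0 * cnj p0 = 1" using cmod2_eq[of p0] K by simp
  ultimately have "p = p0" by (metis mult.assoc mult_1)
  moreover have "(cmod (a - a0))\<^sup>2 + (cmod (s - s0))\<^sup>2 / 4 \<le> 0" using gap b \<open>l w = 1\<close> by simp
  then have "a = a0" "s = s0"
    using zero_le_power2[of "cmod (a - a0)"] zero_le_power2[of "cmod (s - s0)"]
    by (smt (verit) divide_nonneg_nonneg eq_iff_diff_eq_0 norm_eq_zero zero_eq_power2 divide_eq_0_iff)+
  ultimately show "w0 \<in> B" using w w0_eq w_eq by simp
qed

lemma distinguished_boundary_pentablock: "distinguished_boundary pentablock = penta_torus"
  unfolding distinguished_boundary_def
  by (rule Least_equality) (use closed_penta_torus is_boundary_penta_torus penta_torus_minimal in auto)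

section \<open>Blaschke factors and the automorphisms of the disc\<close>

lemma blaschke_denominator_nonzero:
  assumes "cmod \<alpha> < 1" "cmod z \<le> 1"
  shows "cnj \<alpha> * z - 1 \<noteq> 0"
proof
  assume "cnj \<alpha> * z - 1 = 0"
  then have "cmod (cnj \<alpha> * z) = 1" by simp
  moreover have "cmod \<alpha> * cmod z < 1"
    using mult_left_mono[OF assms(2), of "cmod \<alpha>"] assms(1) by simp
  ultimately show False by (simp add: norm_mult)
qed

lemma blaschke_eq_Moebius: "blaschke \<alpha> z = - Moebius_function 0 \<alpha> z"
proof -
  have "cnj \<alpha> * z - 1 = - (1 - cnj \<alpha> * z)" by simp
  then show ?thesis unfolding blaschke_def Moebius_function_simple by (metis minus_divide_right)
qed

lemma blaschke_in_disc: "cmod \<alpha> < 1 \<Longrightarrow> cmod z < 1 \<Longrightarrow> cmod (blaschke \<alpha> z) < 1"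
  using Moebius_function_norm_lt_1[of \<alpha> z 0] by (simp add: blaschke_eq_Moebius)

lemma blaschke_holomorphic: "cmod \<alpha> < 1 \<Longrightarrow> blaschke \<alpha> holomorphic_on unit_disc"
  unfolding blaschke_def using blaschke_denominator_nonzero
  by (intro holomorphic_intros) auto

lemma one_minus_mult_cnj_nonzero: "cmod \<alpha> < 1 \<Longrightarrow> 1 - \<alpha> * cnj \<alpha> \<noteq> 0"
  using blaschke_denominator_nonzero[of \<alpha> \<alpha>] by (auto simp: mult.commute)

text \<open>The sign of the denominator in \<open>blaschke\<close> makes each factor its own
  inverse.\<close>

lemma blaschke_involution:
  assumes "cmod \<alpha> < 1" "cmod z \<le> 1"
  shows "blaschke \<alpha> (blaschke \<alpha> z) = z"
proof -
  define d where "d = cnj \<alpha> * z - 1"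
  have d: "d \<noteq> 0" using blaschke_denominator_nonzero assms by (simp add: d_def)
  have "(z - \<alpha>) / d - \<alpha> = z * (1 - \<alpha> * cnj \<alpha>) / d" "cnj \<alpha> * ((z - \<alpha>) / d) - 1 = (1 - \<alpha> * cnj \<alpha>) / d"
    using d by (simp_all add: field_simps) (simp_all add: d_def algebra_simps)
  then show ?thesis
    using d one_minus_mult_cnj_nonzero[OF assms(1)]
    unfolding blaschke_def by (simp add: d_def)
qed

text \<open>By the involution property the inverse is
  \<open>blaschke \<alpha> (cnj \<eta> * w)\<close>; \<open>inv_into\<close> agrees with it on the
  open disc, which is enough for holomorphy there.\<close>

lemma rotated_blaschke_in_aut_disc:
  assumes "\<eta> \<in> unit_circle" "\<alpha> \<in> unit_disc"
  shows "(\<lambda>z. \<eta> * blaschke \<alpha> z) \<in> aut_disc"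
proof -
  let ?v = "\<lambda>z. \<eta> * blaschke \<alpha> z" and ?u = "\<lambda>w. blaschke \<alpha> (cnj \<eta> * w)"
  have \<alpha>: "cmod \<alpha> < 1" and \<eta>: "cmod \<eta> = 1" using assms by auto
  have u: "\<eta> * cnj \<eta> = 1" using cmod2_eq[of \<eta>] \<eta> by simp
  have 1: "?v ` unit_disc \<subseteq> unit_disc" "?u ` unit_disc \<subseteq> unit_disc"
    using blaschke_in_disc[OF \<alpha>] \<eta> by (auto simp: norm_mult)
  have vu: "?v (?u w) = w" if "w \<in> unit_disc" for w
    using blaschke_involution[OF \<alpha>, of "cnj \<eta> * w"] that \<eta> u by (simp add: norm_mult flip: mult.assoc)
  have uv: "?u (?v z) = z" if "z \<in> unit_disc" for z
    using blaschke_involution[OF \<alpha>, of z] that u by (simp add: mult.commute flip: mult.assoc)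
  have bij: "bij_betw ?v unit_disc unit_disc"
    using vu uv 1 by (intro bij_betw_byWitness[where f' = ?u]) auto
  have hol: "?v holomorphic_on unit_disc"
    using blaschke_holomorphic[OF \<alpha>] by (intro holomorphic_intros)
  have "(blaschke \<alpha> \<circ> (\<lambda>w. cnj \<eta> * w)) holomorphic_on unit_disc"
    using \<eta> by (intro holomorphic_on_compose_gen[where t = unit_disc] holomorphic_intros
        blaschke_holomorphic[OF \<alpha>]) (auto simp: norm_mult)
  then have hol_u: "?u holomorphic_on unit_disc" by (simp add: o_def)
  have inv: "inv_into unit_disc ?v w = ?u w" if "w \<in> unit_disc" for w
  proof (rule inv_into_f_eq)
    show "inj_on ?v unit_disc" using bij by (rule bij_betw_imp_inj_on)
    show "?u w \<in> unit_disc" using 1(2) that by blast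
  qed (rule vu[OF that])
  have "inv_into unit_disc ?v holomorphic_on unit_disc"
    by (rule holomorphic_transform[OF hol_u]) (simp only: inv)
  then show ?thesis using bij hol by (simp add: aut_disc_def)
qed

text \<open>With \<open>\<alpha>\<close> the zero of \<open>v\<close>, the map \<open>g\<close>
  fixes \<open>0\<close> and has the left inverse \<open>h\<close> on the disc. The Schwarz lemma
  for both gives equality at one nonzero point, so \<open>g\<close> is a rotation.\<close>

lemma aut_disc_rotated_blaschke:
  assumes "v \<in> aut_disc"
  obtains \<eta> \<alpha> where "\<eta> \<in> unit_circle" "\<alpha> \<in> unit_disc" "\<And>z. z \<in> unit_disc \<Longrightarrow> v z = \<eta> * blaschke \<alpha> z"
proof -
  define u where "u = inv_into unit_disc v"
  have bij: "bij_betw v unit_disc unit_disc" and hv: "v holomorphic_on unit_disc"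
    and hu: "u holomorphic_on unit_disc"
    using assms by (auto simp: aut_disc_def u_def)
  have v: "cmod (v z) < 1" if "cmod z < 1" for z using bij_betwE[OF bij] that by auto
  have u: "cmod (u z) < 1" "v (u z) = z" "u (v z) = z" if "cmod z < 1" for z
    using bij_betwE[OF bij_betw_inv_into[OF bij]] bij_betw_inv_into_right[OF bij]
      bij_betw_inv_into_left[OF bij] that by (auto simp: u_def)
  define \<alpha> where "\<alpha> = u 0"
  have \<alpha>: "cmod \<alpha> < 1" "v \<alpha> = 0" using u by (auto simp: \<alpha>_def)
  note B = blaschke_in_disc[OF \<alpha>(1)] blaschke_involution[OF \<alpha>(1)] blaschke_holomorphic[OF \<alpha>(1)]
  define g h where "g = v \<circ> blaschke \<alpha>" and "h = blaschke \<alpha> \<circ> u"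
  have g: "g holomorphic_on ball 0 1" "g 0 = 0" "\<And>z. cmod z < 1 \<Longrightarrow> cmod (g z) < 1"
    using B v \<alpha> by (auto simp: g_def blaschke_def intro!: holomorphic_on_compose_gen[OF _ hv])
  have h: "h holomorphic_on ball 0 1" "h 0 = 0" "\<And>z. cmod z < 1 \<Longrightarrow> cmod (h z) < 1"
    using B u \<alpha> by (auto simp: h_def \<alpha>_def[symmetric] intro!: holomorphic_on_compose_gen[OF hu])
      (simp add: blaschke_def)
  have hg: "h (g z) = z" if "cmod z < 1" for z
    using that B u by (simp add: g_def h_def)
  have "cmod (g (1/2)) = cmod (1/2)"
    using Schwarz_Lemma(1)[OF g, of "1/2"] Schwarz_Lemma(1)[OF h g(3), of "1/2"] hg[of "1/2"]
    by (simp add: norm_divide)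
  then have "\<exists>z. cmod z < 1 \<and> z \<noteq> 0 \<and> cmod (g z) = cmod z"
    by (intro exI[of _ "1/2"]) (simp add: norm_divide)
  then obtain \<eta> where \<eta>: "\<And>z. cmod z < 1 \<Longrightarrow> g z = \<eta> * z" "cmod \<eta> = 1"
    using Schwarz_Lemma(3)[OF g, of 0] by auto
  have "v z = \<eta> * blaschke \<alpha> z" if "z \<in> unit_disc" for z
    using \<eta>(1)[of "blaschke \<alpha> z"] B that by (simp add: g_def)
  then show ?thesis using that \<eta> \<alpha> by simp
qed

text \<open>The zero of \<open>v\<close> determines \<open>\<alpha>\<close>, and any point where the
  Blaschke factor does not vanish then determines \<open>\<eta>\<close>.\<close>

lemma aut_params_eq:
  assumes "\<eta> \<in> unit_circle" "\<alpha> \<in> unit_disc" "\<And>z. z \<in> unit_disc \<Longrightarrow> v z = \<eta> * blaschke \<alpha> z"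
  shows "aut_params v = (\<eta>, \<alpha>)"
  unfolding aut_params_def
proof (rule the_equality)
  fix x
  assume "case x of (\<eta>, \<alpha>) \<Rightarrow> \<eta> \<in> unit_circle \<and> \<alpha> \<in> unit_disc \<and> (\<forall>z\<in>unit_disc. v z = \<eta> * blaschke \<alpha> z)"
  then obtain \<eta>' \<alpha>' where x: "x = (\<eta>', \<alpha>')" "cmod \<eta>' = 1" "cmod \<alpha>' < 1"
    "\<And>z. z \<in> unit_disc \<Longrightarrow> v z = \<eta>' * blaschke \<alpha>' z" by auto
  have eq: "\<eta> * blaschke \<alpha> z = \<eta>' * blaschke \<alpha>' z" if "cmod z < 1" for z
    using x(4)[of z] assms(3)[of z] that by simp
  have "\<eta>' \<noteq> 0" using x by auto
  then have "\<alpha>' = \<alpha>"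
    using eq[of \<alpha>] assms(2) blaschke_denominator_nonzero[OF x(3), of \<alpha>] by (simp add: blaschke_def)
  moreover obtain z where "cmod z < 1" "blaschke \<alpha> z \<noteq> 0"
  proof (cases "\<alpha> = 0")
    case True
    then show ?thesis by (intro that[of "1/2"]) (auto simp: blaschke_def norm_divide)
  next
    case False
    then show ?thesis by (intro that[of 0]) (auto simp: blaschke_def)
  qed
  ultimately show "x = (\<eta>, \<alpha>)" using eq[of z] x by simp
qed (use assms in auto)

section \<open>Images of the two base points\<close>

lemma sum_product_determine_pair:
  fixes z1 z2 w1 w2 :: complex
  assumes "z1 + z2 = w1 + w2" "z1 * z2 = w1 * w2"
  shows "w1 = z1 \<and> w2 = z2 \<or> w1 = z2 \<and> w2 = z1"
proof -
  have "(w1 - z1) * (w1 - z2) = 0" using assms by algebra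
  then show ?thesis using assms(1) by auto
qed

text \<open>Sum and product fix the pair up to order, and the right-hand side is symmetric, so the
  description in \<open>tau\<close> is unique.\<close>

lemma tau_eq:
  assumes "cmod z1 \<le> 1" "cmod z2 \<le> 1"
  shows "tau v (z1 + z2, z1 * z2) = (aut_ext v z1 + aut_ext v z2, aut_ext v z1 * aut_ext v z2)"
  unfolding tau_def
proof (rule the_equality)
  fix w
  assume "\<exists>w1\<in>cball 0 1. \<exists>w2\<in>cball 0 1. (z1 + z2, z1 * z2) = (w1 + w2, w1 * w2) \<and>
    w = (aut_ext v w1 + aut_ext v w2, aut_ext v w1 * aut_ext v w2)"
  then show "w = (aut_ext v z1 + aut_ext v z2, aut_ext v z1 * aut_ext v z2)"
    using sum_product_determine_pair by (auto simp: add.commute mult.commute) (metis add.commute mult.commute)+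
qed (intro bexI[of _ z1] bexI[of _ z2], use assms in auto)

lemma penta_aut_0_2_1:
  assumes "aut_params v = (\<eta>, \<alpha>)"
  shows "penta_aut \<omega> v (0, 2, 1) = (0, 2 * (\<eta> * blaschke \<alpha> 1), (\<eta> * blaschke \<alpha> 1)\<^sup>2)"
  using tau_eq[of 1 1 v] assms by (simp add: penta_aut_def aut_ext_def power2_eq_square)

text \<open>The pair \<open>(0, 1)\<close> is the symmetrization of \<open>\<i>\<close> and
  \<open>- \<i>\<close>; the two Blaschke denominators there multiply to
  \<open>1 + (cnj \<alpha>)\<^sup>2\<close>.\<close>

lemma penta_aut_1_0_1:
  assumes "aut_params v = (\<eta>, \<alpha>)" "cmod \<alpha> < 1"
  shows "penta_aut \<omega> v (1, 0, 1) =
    (\<omega> * \<eta> * (1 - \<alpha> * cnj \<alpha>) / (1 + (cnj \<alpha>)\<^sup>2), 2 * \<eta> * (\<alpha> + cnj \<alpha>) / (1 + (cnj \<alpha>)\<^sup>2),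
     \<eta>\<^sup>2 * (1 + \<alpha>\<^sup>2) / (1 + (cnj \<alpha>)\<^sup>2))"
    and "1 + (cnj \<alpha>)\<^sup>2 \<noteq> 0"
proof -
  have nz: "cnj \<alpha> * \<i> - 1 \<noteq> 0" "cnj \<alpha> * (- \<i>) - 1 \<noteq> 0"
    by (rule blaschke_denominator_nonzero[OF assms(2)], simp)+
  have den: "(cnj \<alpha> * \<i> - 1) * (cnj \<alpha> * (- \<i>) - 1) = 1 + (cnj \<alpha>)\<^sup>2"
    by (simp add: algebra_simps power2_eq_square)
  then show nz': "1 + (cnj \<alpha>)\<^sup>2 \<noteq> 0" using nz by (metis mult_eq_0_iff)
  have "blaschke \<alpha> \<i> + blaschke \<alpha> (- \<i>)
     = ((\<i> - \<alpha>) * (cnj \<alpha> * (- \<i>) - 1) + (- \<i> - \<alpha>) * (cnj \<alpha> * \<i> - 1)) / (1 + (cnj \<alpha>)\<^sup>2)"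
    unfolding blaschke_def den[symmetric] using nz by (rule add_frac_eq)
  also have "(\<i> - \<alpha>) * (cnj \<alpha> * (- \<i>) - 1) + (- \<i> - \<alpha>) * (cnj \<alpha> * \<i> - 1) = 2 * (\<alpha> + cnj \<alpha>)"
    by (simp add: algebra_simps)
  finally have sum: "blaschke \<alpha> \<i> + blaschke \<alpha> (- \<i>) = 2 * (\<alpha> + cnj \<alpha>) / (1 + (cnj \<alpha>)\<^sup>2)" .
  have prod: "blaschke \<alpha> \<i> * blaschke \<alpha> (- \<i>) = (1 + \<alpha>\<^sup>2) / (1 + (cnj \<alpha>)\<^sup>2)"
    unfolding blaschke_def den[symmetric] times_divide_times_eq
    by (rule arg_cong2[where f = "(/)"]) (simp_all add: algebra_simps power2_eq_square)
  have "tau v (0, 1) = (\<eta> * (blaschke \<alpha> \<i> + blaschke \<alpha> (- \<i>)), \<eta>\<^sup>2 * (blaschke \<alpha> \<i> * blaschke \<alpha> (- \<i>)))"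
    using tau_eq[of \<i> "- \<i>" v] assms(1) by (simp add: aut_ext_def power2_eq_square algebra_simps)
  then show "penta_aut \<omega> v (1, 0, 1) =
    (\<omega> * \<eta> * (1 - \<alpha> * cnj \<alpha>) / (1 + (cnj \<alpha>)\<^sup>2), 2 * \<eta> * (\<alpha> + cnj \<alpha>) / (1 + (cnj \<alpha>)\<^sup>2),
     \<eta>\<^sup>2 * (1 + \<alpha>\<^sup>2) / (1 + (cnj \<alpha>)\<^sup>2))"
    unfolding penta_aut_def using assms(1) cmod2_eq[of \<alpha>] by (simp add: sum prod mult_ac)
qed

section \<open>The two orbits\<close>

text \<open>The double point \<open>1\<close> moves to a double point \<open>\<zeta>\<close> on the
  circle. Conversely \<open>s\<^sup>2 = 4 * p\<close> forces \<open>cmod s = 2\<close> and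
  \<open>a = 0\<close>, and a rotation reaches the point.\<close>

lemma penta_aut_0_2_1_image:
  "{penta_aut \<omega> v (0, 2, 1) | \<omega> v. \<omega> \<in> unit_circle \<and> v \<in> aut_disc} = {(a, s, p) \<in> penta_torus. s\<^sup>2 = 4 * p}"
proof (intro equalityI subsetI)
  fix w assume "w \<in> {penta_aut \<omega> v (0, 2, 1) | \<omega> v. \<omega> \<in> unit_circle \<and> v \<in> aut_disc}"
  then obtain \<omega> v where w: "w = penta_aut \<omega> v (0, 2, 1)" "v \<in> aut_disc" by blast
  obtain \<eta> \<alpha> where \<eta>: "\<eta> \<in> unit_circle" "\<alpha> \<in> unit_disc" "\<And>z. z \<in> unit_disc \<Longrightarrow> v z = \<eta> * blaschke \<alpha> z"
    using aut_disc_rotated_blaschke w(2) by blast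
  define \<zeta> where "\<zeta> = \<eta> * blaschke \<alpha> 1"
  have "cmod (1 - \<alpha>) = cmod (cnj \<alpha> - 1)"
    by (metis complex_cnj_diff complex_cnj_one complex_mod_cnj norm_minus_commute)
  then have \<zeta>: "cmod \<zeta> = 1"
    using \<eta> blaschke_denominator_nonzero[of \<alpha> 1] by (simp add: \<zeta>_def norm_mult norm_divide blaschke_def)
  then have "\<zeta> * cnj \<zeta> = 1" using cmod2_eq[of \<zeta>] by simp
  then have "2 * \<zeta> = cnj (2 * \<zeta>) * \<zeta>\<^sup>2" by (simp, algebra)
  moreover have "w = (0, 2 * \<zeta>, \<zeta>\<^sup>2)"
    using penta_aut_0_2_1[OF aut_params_eq[OF \<eta>]] by (simp add: w(1) \<zeta>_def)
  ultimately show "w \<in> {(a, s, p) \<in> penta_torus. s\<^sup>2 = 4 * p}"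
    using \<zeta> by (simp add: penta_torus_def norm_mult norm_power power_mult_distrib)
next
  fix w assume "w \<in> {(a, s, p) \<in> penta_torus. s\<^sup>2 = 4 * p}"
  then obtain a s p where w: "w = (a, s, p)" "(cmod a)\<^sup>2 + (cmod s)\<^sup>2 / 4 = 1" "cmod p = 1" "s\<^sup>2 = 4 * p"
    by (auto simp: penta_torus_def)
  have s2: "(cmod s)\<^sup>2 = 4" using w(3,4) by (metis mult.right_neutral norm_mult norm_numeral norm_power)
  then have "a = 0" using w(2) by simp
  have "cmod s = 2" using s2 by (metis norm_ge_zero power2_eq_iff_nonneg four_x_squared mult.right_neutral mult_2 numeral_Bit0 numeral_One one_add_one power2_eq_square zero_le_numeral numeral_times_numeral)
  \<comment> \<open>The minus sign compensates \<open>blaschke 0 z = - z\<close>.\<close>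
  let ?v = "\<lambda>z. - s / 2 * blaschke 0 z"
  have \<eta>: "- s / 2 \<in> unit_circle" "0 \<in> unit_disc" using \<open>cmod s = 2\<close> by (auto simp: norm_divide)
  have "penta_aut 1 ?v (0, 2, 1) = w"
    unfolding penta_aut_0_2_1[OF aut_params_eq[OF \<eta> refl]]
    using w \<open>a = 0\<close> by (simp add: blaschke_def power_divide)
  then show "w \<in> {penta_aut \<omega> v (0, 2, 1) | \<omega> v. \<omega> \<in> unit_circle \<and> v \<in> aut_disc}"
    using rotated_blaschke_in_aut_disc[OF \<eta>] by fastforce
qed

text \<open>One inclusion rests on \<open>(1 - \<alpha> * cnj \<alpha>)\<^sup>2 + (\<alpha> + cnj
  \<alpha>)\<^sup>2 = D * cnj D\<close> and on \<open>a \<noteq> 0\<close>. For the other,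
  \<open>\<eta>\<close> is a square root of \<open>p\<close>, a real \<open>\<alpha>\<close> adjusts
  \<open>s\<close>, and \<open>\<omega>\<close> the phase of \<open>a\<close>.\<close>

lemma penta_aut_1_0_1_image:
  "{penta_aut \<omega> v (1, 0, 1) | \<omega> v. \<omega> \<in> unit_circle \<and> v \<in> aut_disc} = {(a, s, p) \<in> penta_torus. s\<^sup>2 \<noteq> 4 * p}"
proof (intro equalityI subsetI)
  fix w assume "w \<in> {penta_aut \<omega> v (1, 0, 1) | \<omega> v. \<omega> \<in> unit_circle \<and> v \<in> aut_disc}"
  then obtain \<omega> v where w: "w = penta_aut \<omega> v (1, 0, 1)" "v \<in> aut_disc" "cmod \<omega> = 1" by auto
  obtain \<eta> \<alpha> where \<eta>: "\<eta> \<in> unit_circle" "\<alpha> \<in> unit_disc" "\<And>z. z \<in> unit_disc \<Longrightarrow> v z = \<eta> * blaschke \<alpha> z"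
    using aut_disc_rotated_blaschke w(2) by blast
  have \<alpha>: "cmod \<alpha> < 1" and n: "cmod \<eta> = 1" using \<eta> by auto
  define D where "D = 1 + (cnj \<alpha>)\<^sup>2"
  define a s p where "a = \<omega> * \<eta> * (1 - \<alpha> * cnj \<alpha>) / D" and "s = 2 * \<eta> * (\<alpha> + cnj \<alpha>) / D"
    and "p = \<eta>\<^sup>2 * cnj D / D"
  have w_eq: "w = (a, s, p)"
    using penta_aut_1_0_1(1)[OF aut_params_eq[OF \<eta>] \<alpha>] by (simp add: w a_def s_def p_def D_def)
  have D: "D \<noteq> 0" using penta_aut_1_0_1(2)[OF aut_params_eq[OF \<eta>] \<alpha>] by (simp add: D_def)
  have u: "\<eta> * cnj \<eta> = 1" using cmod2_eq[of \<eta>] n by simp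
  have "cnj s * p = 2 * (\<eta> * cnj \<eta>) * \<eta> * (\<alpha> + cnj \<alpha>) / D"
    using D by (simp add: s_def p_def power2_eq_square add.commute mult_ac)
  then have 1: "s = cnj s * p" using u by (simp add: s_def)
  have 2: "cmod p = 1" using D n by (simp add: p_def norm_mult norm_divide norm_power)
  have "complex_of_real ((cmod (1 - \<alpha> * cnj \<alpha>))\<^sup>2 + (cmod (\<alpha> + cnj \<alpha>))\<^sup>2) = complex_of_real ((cmod D)\<^sup>2)"
    unfolding of_real_add cmod2_eq by (simp add: D_def algebra_simps power2_eq_square)
  then have "(cmod (1 - \<alpha> * cnj \<alpha>))\<^sup>2 + (cmod (\<alpha> + cnj \<alpha>))\<^sup>2 = (cmod D)\<^sup>2"
    using of_real_eq_iff by blast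
  moreover have "(cmod a)\<^sup>2 + (cmod s)\<^sup>2 / 4 = ((cmod (1 - \<alpha> * cnj \<alpha>))\<^sup>2 + (cmod (\<alpha> + cnj \<alpha>))\<^sup>2) / (cmod D)\<^sup>2"
    using n w(3) by (simp add: a_def s_def norm_mult norm_divide power_mult_distrib power_divide add_divide_distrib)
  ultimately have 3: "(cmod a)\<^sup>2 + (cmod s)\<^sup>2 / 4 = 1" using D by simp
  have "a \<noteq> 0" using D n w(3) one_minus_mult_cnj_nonzero[OF \<alpha>] by (auto simp: a_def)
  then have "(cmod a)\<^sup>2 > 0" by simp
  then have "(cmod s)\<^sup>2 \<noteq> 4" using 3 by linarith
  then have "cmod (s\<^sup>2) \<noteq> cmod (4 * p)" using 2 by (simp add: norm_mult norm_power)
  then show "w \<in> {(a, s, p) \<in> penta_torus. s\<^sup>2 \<noteq> 4 * p}"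
    using 1 2 3 by (auto simp: w_eq penta_torus_def)
next
  fix w assume "w \<in> {(a, s, p) \<in> penta_torus. s\<^sup>2 \<noteq> 4 * p}"
  then obtain a s p where w: "w = (a, s, p)" "(cmod a)\<^sup>2 + (cmod s)\<^sup>2 / 4 = 1" "cmod p = 1"
    "s = cnj s * p" "s\<^sup>2 \<noteq> 4 * p"
    by (auto simp: penta_torus_def)
  have "(cmod s)\<^sup>2 \<le> 4" using w(2) zero_le_power2[of "cmod a"] by linarith
  then have "cmod s \<le> 2" using power2_le_imp_le[of "cmod s" 2] by simp
  then obtain \<eta> t where \<eta>: "cmod \<eta> = 1" "\<eta>\<^sup>2 = p" "s = \<eta> * of_real t" "\<bar>t\<bar> \<le> 2"
    using symmetrized_torus w by metis
  have "t\<^sup>2 \<noteq> 4"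
  proof
    assume "t\<^sup>2 = 4"
    then have "(complex_of_real t)\<^sup>2 = 4" by (metis of_real_numeral of_real_power)
    then show False using w(5) unfolding \<eta>(3) \<eta>(2)[symmetric] by (simp add: power_mult_distrib)
  qed
  moreover have "t\<^sup>2 \<le> 4" using \<eta>(4) abs_le_square_iff[of t 2] by simp
  ultimately have "t\<^sup>2 < 4" by simp
  define q where "q = sqrt (4 - t\<^sup>2)"
  have q: "q > 0" "q\<^sup>2 = 4 - t\<^sup>2" using \<open>t\<^sup>2 < 4\<close> by (auto simp: q_def)
  \<comment> \<open>Half-angle substitution: for \<open>t = 2 * sin \<phi>\<close> and
    \<open>q = 2 * cos \<phi>\<close> this is \<open>tan (\<phi> / 2)\<close>, which solves
    \<open>4 * x / (1 + x\<^sup>2) = t\<close>.\<close>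
  define x where "x = t / (2 + q)"
  have x2: "x\<^sup>2 = (4 - q\<^sup>2) / (2 + q)\<^sup>2" using q by (simp add: x_def power_divide)
  have f: "(4 - q\<^sup>2) = (2 - q) * (2 + q)" by (simp add: power2_eq_square algebra_simps)
  have x2': "x\<^sup>2 = (2 - q) / (2 + q)" unfolding x2 f using q by (simp add: power2_eq_square)
  have px: "1 + x\<^sup>2 = 4 / (2 + q)" "1 - x\<^sup>2 = 2 * q / (2 + q)"
    unfolding x2' using q by (simp_all add: field_simps)
  have "x\<^sup>2 < 1" using px(2) q by (smt (verit) divide_pos_pos)
  then have "\<bar>x\<bar> < 1" using abs_square_less_1 by blast
  then have \<alpha>: "cmod (of_real x) < 1" by simp
  have "(cmod a)\<^sup>2 = (q / 2)\<^sup>2" using w(2) q \<eta> by (simp add: norm_mult power_divide)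
  then have aq: "cmod a = q / 2" using q by (simp add: power2_eq_iff_nonneg)
  define \<omega> where "\<omega> = a / (\<eta> * of_real (q / 2))"
  have \<omega>: "\<omega> \<in> unit_circle" using aq q \<eta> by (simp add: \<omega>_def norm_divide norm_mult)
  let ?v = "\<lambda>z. \<eta> * blaschke (of_real x) z"
  have \<eta>': "\<eta> \<in> unit_circle" "complex_of_real x \<in> unit_disc" using \<eta> \<alpha> by auto
  have "2 * (x + x) = 4 * t / (2 + q)" by (simp add: x_def)
  then have r: "(1 - x\<^sup>2) / (1 + x\<^sup>2) = q / 2" "2 * (x + x) / (1 + x\<^sup>2) = t"
    unfolding px using q by simp_all
  have "1 + x\<^sup>2 \<noteq> 0" by (smt (verit) zero_le_power2)
  then have one: "(1 + (complex_of_real x)\<^sup>2) \<noteq> 0" by (metis of_real_1 of_real_add of_real_eq_0_iff of_real_power)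
  have "penta_aut \<omega> ?v (1, 0, 1) = (\<omega> * \<eta> * of_real ((1 - x\<^sup>2) / (1 + x\<^sup>2)),
     \<eta> * of_real (2 * (x + x) / (1 + x\<^sup>2)), \<eta>\<^sup>2)"
    using penta_aut_1_0_1(1)[OF aut_params_eq[OF \<eta>' refl] \<alpha>] one by (simp add: power2_eq_square)
  also have "\<dots> = w"
    unfolding r using w(1) \<eta> q by (auto simp: \<omega>_def)
  finally show "w \<in> {penta_aut \<omega> v (1, 0, 1) | \<omega> v. \<omega> \<in> unit_circle \<and> v \<in> aut_disc}"
    using rotated_blaschke_in_aut_disc[OF \<eta>'] \<omega> by blast
qed

text \<open>As \<open>penta_torus\<close> lies in the closure, membership in the variety reduces on
  it to \<open>s\<^sup>2 = 4 * p\<close>, the condition separating the two orbits.\<close>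

theorem theorem2p7:
  "distinguished_boundary pentablock =
     {penta_aut \<omega> v (1, 0, 1) | \<omega> v. \<omega> \<in> unit_circle \<and> v \<in> aut_disc} \<union>
     {penta_aut \<omega> v (0, 2, 1) | \<omega> v. \<omega> \<in> unit_circle \<and> v \<in> aut_disc} \<and>
   distinguished_boundary pentablock \<inter> pentablock_variety =
     {penta_aut \<omega> v (0, 2, 1) | \<omega> v. \<omega> \<in> unit_circle \<and> v \<in> aut_disc} \<and>
   distinguished_boundary pentablock - pentablock_variety =
     {penta_aut \<omega> v (1, 0, 1) | \<omega> v. \<omega> \<in> unit_circle \<and> v \<in> aut_disc}"
  unfolding penta_aut_0_2_1_image penta_aut_1_0_1_image distinguished_boundary_pentablock pentablock_variety_def
  using penta_torus_subset by auto

end
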